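(* Let $d\in\mathbb{N}^+$ and let $k:\mathbb{R}^d\times\mathbb{R}^d\to\mathbb{R}$ be a continuous, bounded, shift-invariant kernel whose spectral measure $\Lambda$ (given by Bochner's theorem) is a Borel probability measure on $\mathbb{R}^d$, i.e. $k(\mathbf{x},\mathbf{y})=\int_{\mathbb{R}^d}\cos\big(\boldsymbol{\omega}^T(\mathbf{x}-\mathbf{y})\big)\,\mathrm{d}\Lambda(\boldsymbol{\omega})$ for all $\mathbf{x},\mathbf{y}\in\mathbb{R}^d$. Fix multi-indices $\mathbf{p},\mathbf{q}\in\mathbb{N}^d$ and let $$\sigma_{\mathbf{p},\mathbf{q}}=\sqrt{\int_{\mathbb{R}^d}\big|\boldsymbol{\omega}^{\mathbf{p}+\mathbf{q}}\big|^2\,\mathrm{d}\Lambda(\boldsymbol{\omega})}\in(0,\infty),\qquad C_{\mathbf{p},\mathbf{q}}=\frac{\sqrt{\int_{\mathbb{R}^d}\big|\boldsymbol{\omega}^{\mathbf{p}+\mathbf{q}}\big|^2\|\boldsymbol{\omega}\|_2^2\,\mathrm{d}\Lambda(\boldsymbol{\omega})}}{\sigma_{\mathbf{p},\mathbf{q}}},$$ and assume $C_{\mathbf{p},\mathbf{q}}<\infty$ and that for some constant $K\ge 1$ the Bernstein condition $$\int_{\mathbb{R}^d}\frac{|\boldsymbol{\omega}^{\mathbf{p}+\mathbf{q}}|^n}{(\sigma_{\mathbf{p},\mathbf{q}})^n}\,\mathrm{d}\Lambda(\boldsymbol{\omega})\le\frac{n!}{2}K^{n-2},\qquad n=2,3,\ldots$$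 holds. Let $m\in\mathbb{N}^+$, let $\boldsymbol{\omega}_1,\ldots,\boldsymbol{\omega}_m$ be i.i.d. with law $\Lambda$ (joint law $\Lambda^m$), and define $$\widehat{\partial^{\mathbf{p},\mathbf{q}}k}(\mathbf{x},\mathbf{y})=\frac{1}{m}\sum_{j=1}^m\big\langle\partial^{\mathbf{p}}\phi_{\boldsymbol{\omega}_j}(\mathbf{x}),\partial^{\mathbf{q}}\phi_{\boldsymbol{\omega}_j}(\mathbf{y})\big\rangle_{\mathbb{R}^2},\qquad \phi_{\boldsymbol{\omega}}(\mathbf{x})=\big(\cos(\boldsymbol{\omega}^T\mathbf{x}),\sin(\boldsymbol{\omega}^T\mathbf{x})\big).$$ Let $L_m=\frac{\sqrt{6}K}{2\sqrt{m}}$, $C_1=14\sqrt{6\ln 2}+1$, $C_2=36K[\ln 2+1]$, and $C_3=7\sqrt{6}\left(1+\frac{\sqrt{\pi}}{(\ln 2)^{3/2}}\right)$. Then for every $t>0$ and every compact set $\mathscr{S}\subset\mathbb{R}^d$, $$\Lambda^m\Bigg(\Big\{\boldsymbol{\omega}_{1:m}:\ \sup_{\mathbf{x},\mathbf{y}\in\mathscr{S}}\big|\partial^{\mathbf{p},\mathbf{q}}k(\mathbf{x},\mathbf{y})-\widehat{\partial^{\mathbf{p},\mathbf{q}}k}(\mathbf{x},\mathbf{y})\big|\ \ge\ \sigma_{\mathbf{p},\mathbf{q}}\Big(\frac{C_3\sqrt{d\ln(16|\mathscr{S}|C_{\mathbf{p},\mathbf{q}}+4)}}{\sqrt{m}}+\frac{C_1}{\sqrt{m}}+\frac{C_2}{m}+\frac{24\sqrt{6}}{\sqrt{m}}\Big[\sqrt{t}+\frac{L_m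 t}{2}\Big]\Big)\Big\}\Bigg)\le 2e^{-t}.$$
   Context: For a multi-index $\mathbf{p}\in\mathbb{N}^d$ and $\mathbf{v}\in\mathbb{R}^d$, $\mathbf{v}^{\mathbf{p}}=\prod_{j=1}^d v_j^{p_j}$ and $|\mathbf{p}|=\sum_j p_j$. $\partial^{\mathbf{p}}h(\mathbf{x})=\frac{\partial^{|\mathbf{p}|}h(\mathbf{x})}{\partial_{x_1}^{p_1}\cdots\partial_{x_d}^{p_d}}$ (applied componentwise to vector-valued $h$), and $\partial^{\mathbf{p},\mathbf{q}}g(\mathbf{x},\mathbf{y})=\frac{\partial^{|\mathbf{p}|+|\mathbf{q}|}g(\mathbf{x},\mathbf{y})}{\partial_{x_1}^{p_1}\cdots\partial_{x_d}^{p_d}\partial_{y_1}^{q_1}\cdots\partial_{y_d}^{q_d}}$. $|\mathscr{S}|=\sup_{\mathbf{x},\mathbf{y}\in\mathscr{S}}\|\mathbf{x}-\mathbf{y}\|_2$ is the diameter of $\mathscr{S}$; $\ln$ is the natural logarithm.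
   Formalization: The formal theorem additionally assumes that the partial derivatives making up ∂^{p,q}k exist everywhere, taken in one fixed order (y first, then x); the stated moment conditions alone do not guarantee that ∂^{p,q}k exists. *)

theory Defs
  imports "HOL-Analysis.Analysis" "HOL-Probability.Probability"
begin

definition partial_dir :: "'n::finite \<Rightarrow> (real^'n \<Rightarrow> real) \<Rightarrow> real^'n \<Rightarrow> real" where
  "partial_dir i f x = deriv (\<lambda>t. f (x + t *\<^sub>R axis i 1)) 0"

fun pd_list :: "'n::finite list \<Rightarrow> (real^'n \<Rightarrow> real) \<Rightarrow> real^'n \<Rightarrow> real" where
  "pd_list [] f = f"
| "pd_list (i # is) f = partial_dir i (pd_list is f)"

fun pd_exists :: "'n::finite list \<Rightarrow> (real^'n \<Rightarrow> real) \<Rightarrow> bool" where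
  "pd_exists [] f = True"
| "pd_exists (i # is) f = (pd_exists is f \<and>
     (\<forall>x. (\<lambda>t. pd_list is f (x + t *\<^sub>R axis i 1)) differentiable (at 0)))"

text \<open>A list of coordinates in which coordinate i occurs exactly p i times
  (an ordering of the differentiations prescribed by the multi-index p).\<close>
definition mi_list :: "('n::finite \<Rightarrow> nat) \<Rightarrow> 'n list" where
  "mi_list p = (SOME l. \<forall>i. count_list l i = p i)"

definition mpartial :: "('n::finite \<Rightarrow> nat) \<Rightarrow> (real^'n \<Rightarrow> real) \<Rightarrow> real^'n \<Rightarrow> real" where
  "mpartial p f = pd_list (mi_list p) f"

definition mpartial2 :: "('n::finite \<Rightarrow> nat) \<Rightarrow> ('n \<Rightarrow> nat) \<Rightarrow>
    (real^'n \<Rightarrow> real^'n \<Rightarrow> real) \<Rightarrow> real^'n \<Rightarrow> real^'n \<Rightarrow> real" where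
  "mpartial2 p q g x y = mpartial p (\<lambda>x'. mpartial q (\<lambda>y'. g x' y') y) x"

definition mpartial2_exists :: "('n::finite \<Rightarrow> nat) \<Rightarrow> ('n \<Rightarrow> nat) \<Rightarrow>
    (real^'n \<Rightarrow> real^'n \<Rightarrow> real) \<Rightarrow> bool" where
  "mpartial2_exists p q g \<longleftrightarrow>
     (\<forall>x'. pd_exists (mi_list q) (\<lambda>y'. g x' y')) \<and>
     (\<forall>y. pd_exists (mi_list p) (\<lambda>x'. mpartial q (\<lambda>y'. g x' y') y))"

definition mono :: "('n::finite \<Rightarrow> nat) \<Rightarrow> real^'n \<Rightarrow> real" where
  "mono p v = (\<Prod>j\<in>UNIV. (v $ j) ^ p j)"

text \<open>RFF estimator of \<partial>^{p,q}k: (1/m) sum_j <\<partial>^p \<phi>_{w_j}(x), \<partial>^q \<phi>_{w_j}(y)>, with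
  \<phi>_w(x) = (cos(w^T x), sin(w^T x)) differentiated componentwise.\<close>
definition rff_deriv :: "('n::finite \<Rightarrow> nat) \<Rightarrow> ('n \<Rightarrow> nat) \<Rightarrow> nat \<Rightarrow> (nat \<Rightarrow> real^'n)
    \<Rightarrow> real^'n \<Rightarrow> real^'n \<Rightarrow> real" where
  "rff_deriv p q m W x y = (1 / real m) * (\<Sum>j<m.
      mpartial p (\<lambda>z. cos (W j \<bullet> z)) x * mpartial q (\<lambda>z. cos (W j \<bullet> z)) y
    + mpartial p (\<lambda>z. sin (W j \<bullet> z)) x * mpartial q (\<lambda>z. sin (W j \<bullet> z)) y)"

end

theory Submission
  imports Defs
begin

text \<open>
  Both \<open>\<partial>\<^sup>p\<^sup>,\<^sup>q k\<close> and its estimator depend on \<open>z = x - y\<close> only: they are the mean and the empirical mean of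
  \<open>h\<^sub>z(\<omega>) = \<omega>\<^sup>p\<^sup>+\<^sup>q cos (\<omega> \<bullet> z + \<phi>)\<close>. Lower order moments of \<open>\<Lambda>\<close> may be infinite, so one cannot differentiate
  under the integral sign one derivative at a time; instead one takes differences in all the required
  directions first, so that the integrand is dominated by a multiple of \<open>|\<omega>\<^sup>p\<^sup>+\<^sup>q|\<close>, and then
  passes to the limit in one increment after the other.

  The centred sums \<open>X\<^sub>z\<close> are bounded uniformly over the ball of radius \<open>diameter S\<close> in two steps.
  In expectation: log-sum-exp satisfies \<open>\<Psi>(v + \<xi>) \<le> \<Psi>(v) + \<langle>\<nabla>\<Psi>(v), \<xi>\<rangle> + \<parallel>\<xi>\<parallel>\<^sup>2/2\<close> in the maximum norm, which
  bounds the expected maximum of \<open>N\<close> centred sums by \<open>2 \<surd>(2 m ln (2 N))\<close> times the L2 norm of an envelope;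
  as \<open>|\<omega>\<^sup>p\<^sup>+\<^sup>q| \<parallel>\<omega>\<parallel> \<parallel>z - z'\<parallel>\<close> is an envelope for the increments, chaining over deterministic dyadic
  nets needs no more than the second moment defining \<open>C\<close>.
  In probability: changing one sample moves the maximum by at most the sum of two envelopes, so the
  Bernstein condition yields an exponential moment bound for the maximum around its mean
  (Yurinskii's inequality).
\<close>


section \<open>Differentiating under the integral\<close>

text \<open>Exponents are listed in the order of differentiation, so that recursion runs in step
  with \<open>pd_list\<close> and multi-indices are added by concatenation.\<close>

definition mono_list :: "'n::finite list \<Rightarrow> real^'n \<Rightarrow> real" where
  "mono_list l w = prod_list (map (\<lambda>i. w $ i) l)"

lemma mono_list_simps [simp]:
  "mono_list [] w = 1"
  "mono_list (i # l) w = w $ i * mono_list l w"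
  "mono_list (l @ l') w = mono_list l w * mono_list l' w"
  by (simp_all add: mono_list_def)

lemma mono_list_eq_mono: "mono_list l w = mono (count_list l) w"
proof (induction l)
  case (Cons i l)
  have "(\<Prod>j\<in>UNIV. w $ j ^ count_list (i # l) j) =
      (\<Prod>j\<in>UNIV. (if i = j then w $ j else 1) * w $ j ^ count_list l j)"
    by (intro prod.cong) auto
  then show ?case
    using Cons.IH by (simp add: mono_def prod.distrib)
qed (simp add: mono_def)

text \<open>\<open>mi_list\<close> is defined by choice and means nothing until some list with the
  prescribed counts exists; any listing of the multiset with multiplicities \<open>p\<close> is
  one.\<close>

lemma count_list_mi_list: "count_list (mi_list p) i = p i"
proof -
  obtain l where l: "mset l = (\<Sum>i\<in>UNIV. replicate_mset (p i) i)"
    using ex_mset by blast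
  have "\<forall>i. count_list l i = p i"
    by (simp add: l count_sum flip: count_mset)
  then have "\<forall>i. count_list (mi_list p) i = p i"
    unfolding mi_list_def by (rule someI)
  then show ?thesis ..
qed

lemma mono_list_mi_list: "mono_list (mi_list p) w = mono p w"
  by (simp add: mono_list_eq_mono count_list_mi_list[abs_def])

lemma borel_measurable_mono_list [measurable]: "mono_list l \<in> borel_measurable borel"
  by (induction l) (simp_all add: mono_list_def[abs_def])

lemma inner_axis_shift: "w \<bullet> (x + t *\<^sub>R axis i 1) = w \<bullet> x + t * w $ i" for w :: "real^'n"
  by (simp add: inner_add_right inner_axis)

section \<open>Iterated partial derivatives of cosine and sine waves\<close>

text \<open>Each derivative multiplies by one frequency and advances the phase by
  \<open>pi / 2\<close>, which avoids a case split by parity. The offset \<open>a\<close> covers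
  sine as \<open>a = - (pi / 2)\<close>.\<close>

lemma pd_list_cos:
  fixes w :: "real^'n"
  shows "pd_list l (\<lambda>z. cos (w \<bullet> z + a)) =
    (\<lambda>z. mono_list l w * cos (w \<bullet> z + a + length l * (pi / 2)))"
    and "pd_exists l (\<lambda>z. cos (w \<bullet> z + a))"
proof (induction l)
  case (Cons i l)
  have D: "((\<lambda>t. mono_list l w * cos (w \<bullet> (x + t *\<^sub>R axis i 1) + a + length l * (pi / 2)))
      has_real_derivative
      mono_list (i # l) w * cos (w \<bullet> x + a + length (i # l) * (pi / 2))) (at 0)" for x
    unfolding inner_axis_shift
    using cos_add[of "w \<bullet> x + a + length l * (pi / 2)" "pi / 2"]
    by (auto intro!: derivative_eq_intros simp: algebra_simps add_divide_distrib)
  { case 1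
    show ?case
      using DERIV_imp_deriv[OF D] by (auto simp: Cons.IH(1) partial_dir_def)
  next
    case 2
    show ?case
      using D Cons.IH by (auto simp: real_differentiable_def)
  }
qed auto

lemma pd_list_cos0: "pd_list l (\<lambda>z. cos (w \<bullet> z)) z = mono_list l w * cos (w \<bullet> z + length l * (pi / 2))"
  using pd_list_cos(1)[of l w 0] by simp

lemma pd_list_sin: "pd_list l (\<lambda>z. sin (w \<bullet> z)) z = mono_list l w * sin (w \<bullet> z + length l * (pi / 2))"
proof -
  have "sin x = cos (x + - (pi / 2))" for x :: real
    by (simp only: cos_add cos_minus sin_minus cos_pi_half sin_pi_half)
  then show ?thesis
    using fun_cong[OF pd_list_cos(1)[of l w "- (pi / 2)"], of z] by (simp add: algebra_simps)
qed

section \<open>Iterated differences and their limits\<close>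

text \<open>Every direction carries its own step size, since the steps are sent to zero one after
  the other, always at the head of the list.\<close>

fun differences :: "(real \<times> 'n::finite) list \<Rightarrow> (real^'n \<Rightarrow> real) \<Rightarrow> real^'n \<Rightarrow> real" where
  "differences [] f = f"
| "differences ((a, i) # r) f =
     (\<lambda>z. differences r f (z + a *\<^sub>R axis i 1) - differences r f z)"

text \<open>By the sum-to-product formula, a difference of a cosine wave is a sine factor times
  another cosine wave. The new phase \<open>b\<close> must not depend on \<open>z\<close>, as the
  next difference is taken in \<open>z\<close>; its value is irrelevant.\<close>

lemma differences_cos_eq:
  "\<exists>b. \<forall>z. differences r (\<lambda>z. c * cos (w \<bullet> z + a)) z =
     c * (\<Prod>(e, i)\<leftarrow>r. 2 * sin (e * w $ i / 2)) * cos (w \<bullet> z + b)"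
proof (induction r)
  case (Cons ei r)
  obtain e i where ei: "ei = (e, i)" by force
  obtain b where b: "\<And>z. differences r (\<lambda>z. c * cos (w \<bullet> z + a)) z =
     c * (\<Prod>(e, i)\<leftarrow>r. 2 * sin (e * w $ i / 2)) * cos (w \<bullet> z + b)"
    using Cons.IH by blast
  have *: "cos (u + v) - cos u = 2 * sin (v / 2) * cos (u + (v / 2 + pi / 2))" for u v :: real
  proof -
    have "(u + v + u) / 2 = u + v / 2" "(u - (u + v)) / 2 = - (v / 2)"
      by (simp_all add: field_simps)
    then have "cos (u + v) - cos u = 2 * sin (u + v / 2) * sin (- (v / 2))"
      by (simp only: cos_diff_cos)
    also have "sin (u + v / 2) = - cos (u + (v / 2 + pi / 2))"
      using cos_add[of "u + v / 2" "pi / 2"] by (simp add: add.assoc)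
    finally show ?thesis by simp
  qed
  have "cos (w \<bullet> z + e * w $ i + b) - cos (w \<bullet> z + b) =
     2 * sin (e * w $ i / 2) * cos (w \<bullet> z + (b + (e * w $ i / 2 + pi / 2)))" for z
    using *[of "w \<bullet> z + b" "e * w $ i"] by (simp add: add_ac)
  then have "\<forall>z. differences (ei # r) (\<lambda>z. c * cos (w \<bullet> z + a)) z =
     c * (\<Prod>(e, i)\<leftarrow>ei # r. 2 * sin (e * w $ i / 2)) * cos (w \<bullet> z + (b + (e * w $ i / 2 + pi / 2)))"
    by (simp add: ei b inner_axis_shift mult.assoc flip: right_diff_distrib)
  then show ?case by blast
qed auto

text \<open>From \<open>\<bar>sin u\<bar> \<le> \<bar>u\<bar>\<close>, a difference costs the same
  factor \<open>w $ i\<close> as a derivative, times its step. Differences and derivatives together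
  thus produce one and the same monomial as majorant.\<close>

lemma abs_differences_cos_le:
  "\<bar>differences r (pd_list l (\<lambda>z. cos (w \<bullet> z))) z\<bar> \<le>
    (\<Prod>(e, i)\<leftarrow>r. \<bar>e\<bar>) * \<bar>mono_list (map snd r @ l) w\<bar>"
proof -
  have 1: "\<bar>\<Prod>(e, i)\<leftarrow>r. 2 * sin (e * w $ i / 2)\<bar> \<le> (\<Prod>(e, i)\<leftarrow>r. \<bar>e\<bar>) * \<bar>mono_list (map snd r) w\<bar>"
  proof (induction r)
    case (Cons ei r)
    obtain e i where ei: "ei = (e, i)" by force
    have "\<bar>2 * sin (e * w $ i / 2)\<bar> \<le> \<bar>e\<bar> * \<bar>w $ i\<bar>"
      using abs_sin_x_le_abs_x[of "e * w $ i / 2"] by (simp add: abs_mult)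
    from mult_mono[OF this Cons.IH] show ?case
      by (simp add: ei abs_mult mult_ac)
  qed auto
  have 2: "0 \<le> (\<Prod>(e, i)\<leftarrow>r. \<bar>e\<bar>)"
    by (induction r) auto
  obtain b where b: "differences r (\<lambda>z. mono_list l w * cos (w \<bullet> z + length l * (pi / 2))) z =
     mono_list l w * (\<Prod>(e, i)\<leftarrow>r. 2 * sin (e * w $ i / 2)) * cos (w \<bullet> z + b)"
    using differences_cos_eq[of r "mono_list l w" w "length l * (pi / 2)"] by blast
  have "\<bar>mono_list l w\<bar> * \<bar>\<Prod>(e, i)\<leftarrow>r. 2 * sin (e * w $ i / 2)\<bar> * \<bar>cos (w \<bullet> z + b)\<bar>
    \<le> \<bar>mono_list l w\<bar> * ((\<Prod>(e, i)\<leftarrow>r. \<bar>e\<bar>) * \<bar>mono_list (map snd r) w\<bar>) * 1"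
    using 2 by (intro mult_mono 1 order.refl mult_nonneg_nonneg) auto
  then show ?thesis
    unfolding pd_list_cos0[abs_def] b by (simp add: abs_mult mult_ac)
qed

text \<open>An iterated difference is a finite linear combination of translates, so it commutes with
  the derivative.\<close>

lemma differences_has_partial_dir:
  assumes "\<And>x. (\<lambda>t. f (x + t *\<^sub>R axis i 1)) differentiable (at 0)"
  shows "((\<lambda>t. differences r f (z + t *\<^sub>R axis i 1)) has_real_derivative
           differences r (partial_dir i f) z) (at 0)"
proof (induction r arbitrary: z)
  case Nil
  show ?case
    using assms[of z] by (simp add: partial_dir_def DERIV_deriv_iff_real_differentiable)
next
  case (Cons ej r)
  obtain e j where ej: "ej = (e, j)" by force
  show ?case
    using DERIV_diff[OF Cons.IH[of "z + e *\<^sub>R axis j 1"] Cons.IH[of z]]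
    by (simp add: ej add_ac)
qed

text \<open>The steps \<open>inverse (Suc n)\<close> form a sequence, as dominated convergence
  requires.\<close>

lemma differences_difference_quotient_tendsto:
  assumes "\<And>x. (\<lambda>t. f (x + t *\<^sub>R axis i 1)) differentiable (at 0)"
  shows "(\<lambda>n. differences ((inverse (Suc n), i) # r) f z / inverse (Suc n))
           \<longlonglongrightarrow> differences r (partial_dir i f) z"
proof -
  have "((\<lambda>t. (differences r f (z + t *\<^sub>R axis i 1) - differences r f z) / t)
      \<longlongrightarrow> differences r (partial_dir i f) z) (at 0)"
    using differences_has_partial_dir[OF assms, of r z] by (simp add: DERIV_def)
  moreover have "filterlim (\<lambda>n. inverse (real (Suc n))) (at 0) sequentially"
    unfolding filterlim_at using LIMSEQ_inverse_real_of_nat by simp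
  ultimately show ?thesis
    using filterlim_compose by fastforce
qed

lemma borel_measurable_differences_cos:
  "(\<lambda>w. differences r (pd_list l (\<lambda>z. cos (w \<bullet> z))) z) \<in> borel_measurable borel"
proof (induction r arbitrary: z)
  case (Cons ej r)
  obtain e j where ej: "ej = (e, j)" by force
  show ?case
    using borel_measurable_diff[OF Cons.IH[of "z + e *\<^sub>R axis j 1"] Cons.IH[of z]] by (simp add: ej)
qed (simp add: pd_list_cos0)

text \<open>Induction on the derivatives \<open>l\<close> with the differences \<open>r\<close>
  arbitrary: a derivative is the limit of difference quotients, so its direction moves from
  \<open>l\<close> to \<open>r\<close>. With no derivative left, the identity is linearity of the
  integral of bounded functions. The monomial of \<open>map snd r @ l\<close> never changes, so its
  integrability is the only moment condition.\<close>

lemma differences_integral_cos: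
  fixes \<Lambda> :: "(real^'n) measure"
  assumes "prob_space \<Lambda>" and sets: "sets \<Lambda> = sets borel"
    and ex: "pd_exists l (\<lambda>z. \<integral>w. cos (w \<bullet> z) \<partial>\<Lambda>)"
    and int: "integrable \<Lambda> (mono_list (map snd r @ l))"
  shows "differences r (pd_list l (\<lambda>z. \<integral>w. cos (w \<bullet> z) \<partial>\<Lambda>)) z =
           (\<integral>w. differences r (pd_list l (\<lambda>z. cos (w \<bullet> z))) z \<partial>\<Lambda>)"
proof -
  interpret prob_space \<Lambda> by fact
  have [simp, measurable_cong]: "sets \<Lambda> = sets borel" by fact
  show ?thesis
    using ex int
  proof (induction l arbitrary: r z)
    case Nil
    have "integrable \<Lambda> (\<lambda>w. differences r (\<lambda>z. cos (w \<bullet> z)) z) \<and>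
      differences r (\<lambda>z. \<integral>w. cos (w \<bullet> z) \<partial>\<Lambda>) z = (\<integral>w. differences r (\<lambda>z. cos (w \<bullet> z)) z \<partial>\<Lambda>)" for z
    proof (induction r arbitrary: z)
      case Nil
      show ?case by (auto intro!: integrable_const_bound[where B = 1])
    next
      case (Cons ej r)
      obtain e j where ej: "ej = (e, j)" by force
      show ?case using Cons.IH by (simp add: ej)
    qed
    then show ?case by simp
  next
    case (Cons i l)
    let ?g = "\<lambda>z. \<integral>w. cos (w \<bullet> z) \<partial>\<Lambda>"
    let ?q = "\<lambda>n. (inverse (real (Suc n)), i) # r"
    have "mono_list (map snd (?q n) @ l) = mono_list (map snd r @ i # l)" for n
      by (simp add: fun_eq_iff mult.left_commute)
    then have IH: "differences (?q n) (pd_list l ?g) z =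
        (\<integral>w. differences (?q n) (pd_list l (\<lambda>z. cos (w \<bullet> z))) z \<partial>\<Lambda>)" for n
      using Cons.prems by (intro Cons.IH) (simp_all del: mono_list_simps)
    have "(\<lambda>n. differences (?q n) (pd_list l ?g) z / inverse (Suc n))
        \<longlonglongrightarrow> differences r (pd_list (i # l) ?g) z"
      using differences_difference_quotient_tendsto[of "pd_list l ?g" i r z] Cons.prems by simp
    moreover have "(\<lambda>n. \<integral>w. differences (?q n) (pd_list l (\<lambda>z. cos (w \<bullet> z))) z / inverse (Suc n) \<partial>\<Lambda>)
        \<longlonglongrightarrow> (\<integral>w. differences r (pd_list (i # l) (\<lambda>z. cos (w \<bullet> z))) z \<partial>\<Lambda>)"
    proof (rule integral_dominated_convergence)
      \<comment> \<open>Division by the new step cancels its factor in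
        \<open>abs_differences_cos_le\<close>, which leaves a majorant free of
        \<open>n\<close>.\<close>
      let ?B = "\<lambda>w. (\<Prod>(e, i)\<leftarrow>r. \<bar>e\<bar>) * \<bar>mono_list (map snd r @ i # l) w\<bar>"
      show "integrable \<Lambda> ?B"
        using Cons.prems by (intro integrable_mult_right integrable_abs)
      show "AE w in \<Lambda>. (\<lambda>n. differences (?q n) (pd_list l (\<lambda>z. cos (w \<bullet> z))) z / inverse (Suc n))
          \<longlonglongrightarrow> differences r (pd_list (i # l) (\<lambda>z. cos (w \<bullet> z))) z"
      proof (intro AE_I2)
        fix w
        have "pd_exists (i # l) (\<lambda>z. cos (w \<bullet> z))"
          using pd_list_cos(2)[of "i # l" w 0] by simp
        then show "(\<lambda>n. differences (?q n) (pd_list l (\<lambda>z. cos (w \<bullet> z))) z / inverse (Suc n))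
            \<longlonglongrightarrow> differences r (pd_list (i # l) (\<lambda>z. cos (w \<bullet> z))) z"
          using differences_difference_quotient_tendsto[of "pd_list l (\<lambda>z. cos (w \<bullet> z))" i r z] by simp
      qed
      show "AE w in \<Lambda>. norm (differences (?q n) (pd_list l (\<lambda>z. cos (w \<bullet> z))) z / inverse (Suc n)) \<le> ?B w" for n
        using abs_differences_cos_le[of "?q n" l _ z]
        by (intro AE_I2) (simp add: abs_mult divide_simps mult_ac)
    next
      show "(\<lambda>w. differences r (pd_list (i # l) (\<lambda>z. cos (w \<bullet> z))) z) \<in> borel_measurable \<Lambda>"
        using borel_measurable_differences_cos[of r "i # l" z] by (simp cong: measurable_cong_sets)
      show "(\<lambda>w. differences (?q n) (pd_list l (\<lambda>z. cos (w \<bullet> z))) z / inverse (Suc n)) \<in> borel_measurable \<Lambda>" for n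
        using borel_measurable_differences_cos[of "?q n" l z]
        by (intro borel_measurable_divide) (simp_all cong: measurable_cong_sets)
    qed
    ultimately show ?case
      unfolding integral_divide_zero IH by (rule LIMSEQ_unique)
  qed
qed

section \<open>Translation, scaling and reflection\<close>

text \<open>The factor \<open>c\<close> matches the sign that the reflection in the second argument
  of the kernel leaves behind.\<close>

lemma pd_list_shift:
  "pd_list l (\<lambda>x. c * f (x - y)) = (\<lambda>x. pd_list l (\<lambda>x. c * f x) (x - y))"
  by (induction l) (simp_all add: partial_dir_def fun_eq_iff algebra_simps)

lemma pd_list_cmult:
  assumes "pd_exists l (\<lambda>x. c * f x)" "c \<noteq> 0"
  shows "pd_exists l f \<and> pd_list l (\<lambda>x. c * f x) = (\<lambda>x. c * pd_list l f x)"
  using assms(1)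
proof (induction l)
  case (Cons i l)
  then have IH: "pd_exists l f" "pd_list l (\<lambda>x. c * f x) = (\<lambda>x. c * pd_list l f x)" by auto
  have "(\<lambda>t. c * pd_list l f (x + t *\<^sub>R axis i 1)) differentiable (at 0)" for x
    using Cons.prems by (auto simp only: pd_exists.simps IH(2))
  then have D: "(\<lambda>t. pd_list l f (x + t *\<^sub>R axis i 1)) differentiable (at 0)" for x
    using assms(2) by simp
  have "partial_dir i (\<lambda>x. c * pd_list l f x) x = c * partial_dir i (pd_list l f) x" for x
    unfolding partial_dir_def
    using D[of x] by (intro deriv_cmult) (simp add: field_differentiable_def real_differentiable_def)
  then show ?case
    using IH D by auto
qed auto

text \<open>Chain rule for \<open>y \<mapsto> a - y\<close>: one factor -1 per derivative. Existence
  passes from the reflected function to \<open>g\<close>, because the hypothesis on the kernel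
  concerns its second argument.\<close>

lemma pd_list_reflect:
  assumes "pd_exists l (\<lambda>y. g (a - y))"
  shows "pd_exists l g \<and> (\<forall>y. pd_list l (\<lambda>y. g (a - y)) y = (- 1) ^ length l * pd_list l g (a - y))"
  using assms
proof (induction l)
  case (Cons i l)
  then have IH: "pd_exists l g"
    "\<And>y. pd_list l (\<lambda>y. g (a - y)) y = (- 1) ^ length l * pd_list l g (a - y)" by auto
  let ?c = "(- 1) ^ length l :: real"
  have D: "((\<lambda>t. pd_list l g (x + t *\<^sub>R axis i 1)) has_real_derivative
      - (?c * partial_dir i (pd_list l (\<lambda>y. g (a - y))) (a - x))) (at 0)" for x
  proof -
    let ?f = "\<lambda>t. pd_list l (\<lambda>y. g (a - y)) (a - x + t *\<^sub>R axis i 1)"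
    \<comment> \<open>The point is written as \<open>- 0\<close> to fit
      \<open>DERIV_mirror\<close>.\<close>
    have "(?f has_real_derivative deriv ?f 0) (at (- 0))"
      using Cons.prems by (simp add: DERIV_deriv_iff_real_differentiable)
    from DERIV_cmult[OF DERIV_mirror[THEN iffD1, OF this], of ?c] show ?thesis
      by (simp add: IH(2) partial_dir_def flip: mult.assoc power_mult_distrib)
  qed
  have "pd_exists (i # l) g"
    using IH(1) D by (auto simp: real_differentiable_def)
  moreover have "pd_list (i # l) g (a - y) =
      - (?c * pd_list (i # l) (\<lambda>y. g (a - y)) y)" for y
    using DERIV_imp_deriv[OF D[of "a - y"]] by (simp add: partial_dir_def)
  ultimately show ?case
    by (simp flip: mult.assoc power_mult_distrib)
qed auto

lemma pd_list_append:
  "pd_list (l @ l') f = pd_list l (pd_list l' f)"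
  "pd_exists (l @ l') f \<longleftrightarrow> pd_exists l' f \<and> pd_exists l (pd_list l' f)"
  by (induction l) auto

section \<open>The derivative and its estimator as means of cosine waves\<close>

text \<open>As \<open>k x y = g (x - y)\<close>, derivatives in \<open>x\<close> are translates and
  derivatives in \<open>y\<close> are reflections with sign \<open>(- 1) ^ n\<close>. Absorbing the
  sign turns the phase from \<open>|p| + |q|\<close> quarter turns into \<open>|p| - |q|\<close>,
  the phase in \<open>rff_deriv_eq_sum\<close>.\<close>

lemma mpartial2_eq_integral:
  fixes \<Lambda> :: "(real^'n) measure"
  assumes "prob_space \<Lambda>" and "sets \<Lambda> = sets borel"
    and kernel: "\<And>x y. k x y = (\<integral>w. cos (w \<bullet> (x - y)) \<partial>\<Lambda>)"
    and ex: "mpartial2_exists p q k"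
    and int: "integrable \<Lambda> (mono (\<lambda>j. p j + q j))"
  shows "mpartial2 p q k x y = (\<integral>w. mono (\<lambda>j. p j + q j) w *
    cos (w \<bullet> (x - y) + (real (length (mi_list p)) - real (length (mi_list q))) * (pi / 2)) \<partial>\<Lambda>)"
proof -
  define g where "g = (\<lambda>z. \<integral>w. cos (w \<bullet> z) \<partial>\<Lambda>)"
  define n where "n = length (mi_list q)"
  have k: "k = (\<lambda>x y. g (x - y))" by (simp add: g_def kernel fun_eq_iff)
  have refl: "pd_exists (mi_list q) g"
    "mpartial q (\<lambda>y'. k x' y') y = (- 1) ^ n * pd_list (mi_list q) g (x' - y)" for x' y
    using ex pd_list_reflect[of "mi_list q" g x']
    by (auto simp: mpartial2_exists_def k mpartial_def n_def)
  \<comment> \<open>At \<open>y = 0\<close> the existence hypothesis involves no translation and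
    speaks of \<open>g\<close> itself, up to the sign.\<close>
  have "pd_exists (mi_list p) (\<lambda>x'. (- 1) ^ n * pd_list (mi_list q) g x')"
    using ex[unfolded mpartial2_exists_def, THEN conjunct2, rule_format, of 0] by (simp add: refl)
  from pd_list_cmult[OF this]
  have p: "pd_exists (mi_list p) (pd_list (mi_list q) g)"
    "pd_list (mi_list p) (\<lambda>x. (- 1) ^ n * pd_list (mi_list q) g x) =
      (\<lambda>x. (- 1) ^ n * pd_list (mi_list p) (pd_list (mi_list q) g) x)"
    by auto
  have mono: "mono_list (mi_list p @ mi_list q) = mono (\<lambda>j. p j + q j)"
    by (simp add: fun_eq_iff mono_list_mi_list) (simp add: mono_def power_add prod.distrib)
  have "mpartial2 p q k x y = (- 1) ^ n * pd_list (mi_list p @ mi_list q) g (x - y)"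
    by (simp add: mpartial2_def refl(2) pd_list_append mpartial_def[of p] pd_list_shift p(2))
  also have "pd_list (mi_list p @ mi_list q) g (x - y) =
      (\<integral>w. pd_list (mi_list p @ mi_list q) (\<lambda>z. cos (w \<bullet> z)) (x - y) \<partial>\<Lambda>)"
    using differences_integral_cos[OF assms(1,2), of "mi_list p @ mi_list q" "[]" "x - y"] refl(1) p(1) int
    by (simp add: g_def pd_list_append mono del: mono_list_simps)
  also have "(- 1) ^ n * \<dots> =
      (\<integral>w. (- 1) ^ n * pd_list (mi_list p @ mi_list q) (\<lambda>z. cos (w \<bullet> z)) (x - y) \<partial>\<Lambda>)"
    by simp
  also have "(\<lambda>w. (- 1) ^ n * pd_list (mi_list p @ mi_list q) (\<lambda>z. cos (w \<bullet> z)) (x - y)) =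
    (\<lambda>w. mono (\<lambda>j. p j + q j) w *
      cos (w \<bullet> (x - y) + (real (length (mi_list p)) - real n) * (pi / 2)))"
  proof
    fix w
    have *: "(- 1) ^ n * cos (u + real n * pi) = cos u" for u
    proof (induction n)
      case (Suc n)
      have "cos (u + real (Suc n) * pi) = - cos (u + real n * pi)"
        using cos_periodic_pi[of "u + real n * pi"] by (simp add: algebra_simps)
      with Suc show ?case by simp
    qed simp
    have "(- 1) ^ n * cos (w \<bullet> (x - y) + (length (mi_list p) + n) * (pi / 2)) =
      cos (w \<bullet> (x - y) + (real (length (mi_list p)) - real n) * (pi / 2))"
      using *[of "w \<bullet> (x - y) + (real (length (mi_list p)) - real n) * (pi / 2)"]
      by (simp add: field_simps)
    then show "(- 1) ^ n * pd_list (mi_list p @ mi_list q) (\<lambda>z. cos (w \<bullet> z)) (x - y) =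
      mono (\<lambda>j. p j + q j) w *
        cos (w \<bullet> (x - y) + (real (length (mi_list p)) - real n) * (pi / 2))"
      by (simp add: pd_list_cos0 mono n_def del: mono_list_simps)
  qed
  finally show ?thesis unfolding n_def .
qed

text \<open>The inner product of two phase-shifted pairs of cosine and sine is the cosine of the
  phase difference.\<close>

lemma rff_deriv_eq_sum:
  "rff_deriv p q m W x y = (\<Sum>j<m. mono (\<lambda>j. p j + q j) (W j) *
    cos (W j \<bullet> (x - y) + (real (length (mi_list p)) - real (length (mi_list q))) * (pi / 2))) / m"
proof -
  have "mpartial p (\<lambda>z. cos (w \<bullet> z)) x * mpartial q (\<lambda>z. cos (w \<bullet> z)) y
    + mpartial p (\<lambda>z. sin (w \<bullet> z)) x * mpartial q (\<lambda>z. sin (w \<bullet> z)) y =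
    mono (\<lambda>j. p j + q j) w *
    cos (w \<bullet> (x - y) + (real (length (mi_list p)) - real (length (mi_list q))) * (pi / 2))" for w
  proof -
    have *: "w \<bullet> (x - y) + (real (length (mi_list p)) - real (length (mi_list q))) * (pi / 2) =
      (w \<bullet> x + length (mi_list p) * (pi / 2)) - (w \<bullet> y + length (mi_list q) * (pi / 2))"
      by (simp add: algebra_simps)
    have "mono (\<lambda>j. p j + q j) w = mono p w * mono q w"
      by (simp add: mono_def power_add prod.distrib)
    then show ?thesis
      unfolding * cos_diff mpartial_def pd_list_cos0 pd_list_sin mono_list_mi_list
      by (simp add: algebra_simps)
  qed
  then show ?thesis
    by (simp add: rff_deriv_def)
qed

section \<open>Nets of Euclidean balls\<close>

text \<open>Volume comparison: the balls of radius \<open>r / 2\<close> around the points are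
  disjoint and lie in the ball of radius \<open>R + r / 2\<close>.\<close>

lemma card_separated_le:
  fixes P :: "'a::euclidean_space set"
  assumes "finite P" "P \<subseteq> cball 0 R" "r > 0" "R \<ge> 0"
    and sep: "pairwise (\<lambda>x y. r \<le> dist x y) P"
  shows "real (card P) \<le> (1 + 2 * R / r) ^ DIM('a)"
proof -
  let ?V = "unit_ball_vol (DIM('a))"
  have "disjoint_family_on (\<lambda>x. ball x (r / 2)) P"
    unfolding disjoint_family_on_def
  proof (intro ballI impI, rule ccontr)
    fix x y assume "x \<in> P" "y \<in> P" "x \<noteq> y" "ball x (r / 2) \<inter> ball y (r / 2) \<noteq> {}"
    then obtain z where "dist x z < r / 2" "dist y z < r / 2" by auto
    then have "dist x y < r" using dist_triangle2[of x y z] by simp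
    moreover have "r \<le> dist x y" using sep \<open>x \<in> P\<close> \<open>y \<in> P\<close> \<open>x \<noteq> y\<close> by (simp add: pairwise_def)
    ultimately show False by simp
  qed
  then have "measure lborel (\<Union>x\<in>P. ball x (r / 2)) = (\<Sum>x\<in>P. measure lborel (ball x (r / 2)))"
    using assms(1) by (intro measure_finite_Union) (auto simp: less_top intro!: emeasure_bounded_finite[unfolded infinity_ennreal_def])
  also have "\<dots> = card P * (?V * (r / 2) ^ DIM('a))"
    using assms by (simp add: content_ball)
  finally have "card P * (?V * (r / 2) ^ DIM('a)) = measure lborel (\<Union>x\<in>P. ball x (r / 2))" ..
  also have "\<dots> \<le> measure lborel (ball (0::'a) (R + r / 2))"
  proof (rule measure_mono_fmeasurable)
    show "(\<Union>x\<in>P. ball x (r / 2)) \<subseteq> ball 0 (R + r / 2)"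
    proof safe
      fix x y assume "x \<in> P" "y \<in> ball x (r / 2)"
      then have "norm x \<le> R" "dist x y < r / 2" using assms by auto
      then show "y \<in> ball 0 (R + r / 2)"
        using dist_triangle[of 0 y x] by simp
    qed
    show "ball 0 (R + r / 2) \<in> fmeasurable lborel"
      using emeasure_bounded_finite[OF bounded_ball] by (intro fmeasurableI) auto
  qed (use assms(1) in auto)
  also have "\<dots> = ?V * (R + r / 2) ^ DIM('a)"
    using assms by (simp add: content_ball)
  finally have "card P * (r / 2) ^ DIM('a) \<le> (R + r / 2) ^ DIM('a)"
    by simp
  then have "card P \<le> ((R + r / 2) / (r / 2)) ^ DIM('a)"
    using assms by (subst power_divide, subst pos_le_divide_eq) auto
  also have "(R + r / 2) / (r / 2) = 1 + 2 * R / r"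
    using assms by (simp add: field_simps)
  finally show ?thesis .
qed

text \<open>A separated set of largest cardinality, which exists by
  \<open>card_separated_le\<close>, is a net: an uncovered point could be added to it.\<close>

lemma ball_net:
  fixes R r :: real
  assumes "r > 0" "R \<ge> 0"
  obtains T :: "'a::euclidean_space set" where "finite T" "T \<noteq> {}" "T \<subseteq> cball 0 R"
    "\<And>z. z \<in> cball 0 R \<Longrightarrow> \<exists>u\<in>T. dist z u \<le> r" "real (card T) \<le> (1 + 2 * R / r) ^ DIM('a)"
proof -
  let ?Q = "\<lambda>P :: 'a set. finite P \<and> P \<subseteq> cball 0 R \<and> pairwise (\<lambda>x y. r \<le> dist x y) P"
  obtain N where N: "(1 + 2 * R / r) ^ DIM('a) < real N"
    using reals_Archimedean2 by blast
  have "\<exists>T. ?Q T \<and> (\<forall>P. ?Q P \<longrightarrow> card P \<le> card T)"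
  proof (rule ex_has_greatest_nat[of _ "{}" _ N])
    show "\<forall>P. ?Q P \<longrightarrow> card P < N"
    proof (intro allI impI)
      fix P assume "?Q P"
      then have "real (card P) < real N" using card_separated_le[OF _ _ assms, of P] N by auto
      then show "card P < N" by simp
    qed
  qed auto
  then obtain T where T: "?Q T" and max: "\<And>P. ?Q P \<Longrightarrow> card P \<le> card T" by blast
  have cov: "\<exists>u\<in>T. dist z u \<le> r" if "z \<in> cball 0 R" for z
  proof (rule ccontr)
    assume "\<not> ?thesis"
    then have far: "\<And>u. u \<in> T \<Longrightarrow> r < dist z u" by force
    then have "?Q (insert z T)"
      using T that by (auto simp: pairwise_insert dist_commute less_imp_le)
    moreover have "z \<notin> T" using far[of z] assms by auto
    ultimately show False using max[of "insert z T"] T by simp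
  qed
  moreover have "T \<noteq> {}" using cov[of 0] assms by auto
  ultimately show ?thesis
    using that[of T] T card_separated_le[OF _ _ assms, of T] by blast
qed

section \<open>Expected maxima of finitely many sums\<close>

text \<open>Hoeffding's lemma for the probability weights \<open>p\<close> on \<open>I\<close>. The
  values range over an interval of length \<open>2 * H\<close>, and
  \<open>(2 * H)\<^sup>2 / 8 = H\<^sup>2 / 2\<close>.\<close>

lemma sum_exp_le_hoeffding:
  fixes p x :: "'i \<Rightarrow> real"
  assumes "finite I" "\<And>i. i \<in> I \<Longrightarrow> p i \<ge> 0" "sum p I = 1" and x: "\<And>i. i \<in> I \<Longrightarrow> \<bar>x i\<bar> \<le> H"
  shows "(\<Sum>i\<in>I. p i * exp (x i)) \<le> exp ((\<Sum>i\<in>I. p i * x i) + H\<^sup>2 / 2)"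
proof -
  let ?M = "point_measure I p"
  have "emeasure ?M (space ?M) = 1"
    using assms by (simp add: space_point_measure emeasure_point_measure_finite sum_ennreal)
  then interpret prob_space ?M by (rule prob_spaceI)
  let ?\<mu> = "\<Sum>i\<in>I. p i * x i"
  have \<mu>: "expectation x = ?\<mu>"
    using assms by (simp add: lebesgue_integral_point_measure_finite)
  interpret interval_bounded_random_variable ?M x "- H" H
    by unfold_locales (auto simp: AE_point_measure measurable_point_measure_eq1 dest!: x)
  have "(\<integral>\<^sup>+i. exp (1 * (x i - expectation x)) \<partial>?M) \<le> ennreal (exp (1\<^sup>2 * (H - expectation x - (- H - expectation x))\<^sup>2 / 8))"
    using Hoeffdings_lemma_nn_integral[of 1] by simp
  also have "(\<integral>\<^sup>+i. exp (1 * (x i - expectation x)) \<partial>?M) = (\<Sum>i\<in>I. ennreal (p i * exp (x i - ?\<mu>)))"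
    using assms by (simp add: \<mu> nn_integral_point_measure_finite ennreal_mult' mult.commute)
  also have "\<dots> = ennreal (\<Sum>i\<in>I. p i * exp (x i - ?\<mu>))"
    using assms by (intro sum_ennreal) auto
  finally have "(\<Sum>i\<in>I. p i * exp (x i - ?\<mu>)) \<le> exp (H\<^sup>2 / 2)"
    by (simp add: power2_eq_square)
  then have "exp ?\<mu> * (\<Sum>i\<in>I. p i * exp (x i - ?\<mu>)) \<le> exp ?\<mu> * exp (H\<^sup>2 / 2)"
    by (intro mult_left_mono) auto
  then show ?thesis
    by (simp add: sum_distrib_left exp_add mult.left_commute exp_diff)
qed

text \<open>The gradient of log-sum-exp at \<open>v\<close> consists of probability weights, so the
  second-order error is controlled by Hoeffding's lemma in the maximum norm, without any dependence
  on the number of coordinates.\<close>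

lemma ln_sum_exp_add_le:
  fixes v x :: "'i \<Rightarrow> real"
  assumes "finite I" "I \<noteq> {}" and x: "\<And>i. i \<in> I \<Longrightarrow> \<bar>x i\<bar> \<le> H"
  shows "ln (\<Sum>i\<in>I. exp (v i + x i)) \<le>
    ln (\<Sum>i\<in>I. exp (v i)) + (\<Sum>i\<in>I. exp (v i) / (\<Sum>i\<in>I. exp (v i)) * x i) + H\<^sup>2 / 2"
proof -
  let ?Z = "\<Sum>i\<in>I. exp (v i)"
  have Z: "?Z > 0" using assms by (intro sum_pos) auto
  have "(\<Sum>i\<in>I. exp (v i) / ?Z * exp (x i)) \<le> exp ((\<Sum>i\<in>I. exp (v i) / ?Z * x i) + H\<^sup>2 / 2)"
    using assms Z by (intro sum_exp_le_hoeffding) (auto simp flip: sum_divide_distrib intro: less_imp_le)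
  then have "?Z * (\<Sum>i\<in>I. exp (v i) / ?Z * exp (x i)) \<le> ?Z * exp ((\<Sum>i\<in>I. exp (v i) / ?Z * x i) + H\<^sup>2 / 2)"
    using Z by (intro mult_left_mono) auto
  moreover have "?Z * (\<Sum>i\<in>I. exp (v i) / ?Z * exp (x i)) = (\<Sum>i\<in>I. exp (v i + x i))"
    unfolding sum_distrib_left using Z by (intro sum.cong) (auto simp: exp_add)
  moreover have "(\<Sum>i\<in>I. exp (v i + x i)) > 0" using assms by (intro sum_pos) auto
  ultimately have "ln (\<Sum>i\<in>I. exp (v i + x i)) \<le> ln (?Z * exp ((\<Sum>i\<in>I. exp (v i) / ?Z * x i) + H\<^sup>2 / 2))"
    by (intro ln_mono) auto
  also have "\<dots> = ln ?Z + ((\<Sum>i\<in>I. exp (v i) / ?Z * x i) + H\<^sup>2 / 2)"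
    using Z by (subst ln_mult) auto
  finally show ?thesis by simp
qed

lemma ln_sum_exp_ge:
  fixes v :: "'i \<Rightarrow> real"
  assumes "finite I" "i \<in> I"
  shows "v i \<le> ln (\<Sum>i\<in>I. exp (v i))"
proof -
  have "exp (v i) \<le> (\<Sum>i\<in>I. exp (v i))"
    using assms by (intro member_le_sum) auto
  then show ?thesis by (metis exp_gt_zero ln_exp ln_mono)
qed

text \<open>A crude bound, good enough for integrability.\<close>

lemma abs_ln_sum_exp_le:
  fixes v :: "'i \<Rightarrow> real"
  assumes "finite I" "I \<noteq> {}"
  shows "\<bar>ln (\<Sum>i\<in>I. exp (v i))\<bar> \<le> ln (card I) + (\<Sum>i\<in>I. \<bar>v i\<bar>)"
proof -
  have c: "card I > 0" using assms by (simp add: card_gt_0_iff)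
  have le: "\<bar>v i\<bar> \<le> (\<Sum>i\<in>I. \<bar>v i\<bar>)" if "i \<in> I" for i
    using assms that by (intro member_le_sum) auto
  have "(\<Sum>i\<in>I. exp (v i)) \<le> (\<Sum>i\<in>I. exp (\<Sum>i\<in>I. \<bar>v i\<bar>))"
    using order_trans[OF abs_ge_self le] by (intro sum_mono) simp
  moreover have "(\<Sum>i\<in>I. exp (v i)) > 0" using assms by (intro sum_pos) auto
  ultimately have "ln (\<Sum>i\<in>I. exp (v i)) \<le> ln (card I * exp (\<Sum>i\<in>I. \<bar>v i\<bar>))"
    by (intro ln_mono) auto
  also have "\<dots> = ln (card I) + (\<Sum>i\<in>I. \<bar>v i\<bar>)"
    using c by (subst ln_mult) auto
  finally have "ln (\<Sum>i\<in>I. exp (v i)) \<le> ln (card I) + (\<Sum>i\<in>I. \<bar>v i\<bar>)" .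
  moreover obtain i where "i \<in> I" using assms by blast
  then have "- (\<Sum>i\<in>I. \<bar>v i\<bar>) \<le> ln (\<Sum>i\<in>I. exp (v i))"
    using ln_sum_exp_ge[OF assms(1), of i v] le[of i] by linarith
  moreover have "ln (card I) \<ge> 0" using c by simp
  ultimately show ?thesis by linarith
qed

context prob_space
begin

section \<open>Integrability on finite products\<close>

lemma integrable_real_bound:
  fixes g G :: "'a \<Rightarrow> real"
  assumes "integrable M G" "g \<in> borel_measurable M" "\<And>y. y \<in> space M \<Longrightarrow> \<bar>g y\<bar> \<le> G y"
  shows "integrable M g"
  using assms(1,2)
  by (rule Bochner_Integration.integrable_bound) (auto intro!: AE_I2 order_trans[OF assms(3) abs_ge_self])

lemma integrable_PiM_component:
  fixes f :: "'a \<Rightarrow> real"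
  assumes "j \<in> J" "integrable M f"
  shows "integrable (PiM J (\<lambda>_. M)) (\<lambda>W. f (W j))"
proof -
  interpret prod: product_prob_space "\<lambda>_. M" J by unfold_locales
  have "integrable (distr (PiM J (\<lambda>_. M)) M (\<lambda>W. W j)) f"
    using assms prod.PiM_component[OF assms(1)] by simp
  then show ?thesis
    using assms by (subst (asm) integrable_distr_eq) auto
qed

text \<open>The absolute value is moved inside the inner integral on every section, and Tonelli
  reassembles the norm of \<open>F\<close>. This permits inductions that integrate out one sample at
  a time.\<close>

lemma integrable_expectation_update:
  fixes F :: "('j \<Rightarrow> 'a) \<Rightarrow> real"
  assumes "finite J" "j \<notin> J" and F: "integrable (PiM (insert j J) (\<lambda>_. M)) F"
    and sec: "\<And>W. W \<in> space (PiM J (\<lambda>_. M)) \<Longrightarrow> integrable M (\<lambda>y. F (W(j := y)))"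
  shows "integrable (PiM J (\<lambda>_. M)) (\<lambda>W. expectation (\<lambda>y. F (W(j := y))))"
proof (rule integrableI_bounded)
  interpret prod: product_prob_space "\<lambda>_. M" UNIV by unfold_locales
  have Fm[measurable]: "F \<in> borel_measurable (PiM (insert j J) (\<lambda>_. M))"
    using F by auto
  have "(\<lambda>(W, y). F (W(j := y))) \<in> borel_measurable (PiM J (\<lambda>_. M) \<Otimes>\<^sub>M M)"
    using measurable_compose[OF measurable_add_dim[of j J "\<lambda>_. M"] Fm] by (simp add: case_prod_beta)
  then show "(\<lambda>W. expectation (\<lambda>y. F (W(j := y)))) \<in> borel_measurable (PiM J (\<lambda>_. M))"
    using borel_measurable_lebesgue_integral[of "\<lambda>W y. F (W(j := y))"] by simp
  have "(\<integral>\<^sup>+W. ennreal (norm (expectation (\<lambda>y. F (W(j := y))))) \<partial>PiM J (\<lambda>_. M)) \<le>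
      (\<integral>\<^sup>+W. (\<integral>\<^sup>+y. ennreal (norm (F (W(j := y)))) \<partial>M) \<partial>PiM J (\<lambda>_. M))"
    using sec by (intro nn_integral_mono integral_norm_bound_ennreal)
  also have "\<dots> = (\<integral>\<^sup>+W. ennreal (norm (F W)) \<partial>PiM (insert j J) (\<lambda>_. M))"
    using assms by (intro prod.product_nn_integral_insert[symmetric]) auto
  also have "\<dots> < \<infinity>" using F by (simp add: integrable_iff_bounded)
  finally show "(\<integral>\<^sup>+W. ennreal (norm (expectation (\<lambda>y. F (W(j := y))))) \<partial>PiM J (\<lambda>_. M)) < \<infinity>" .
qed

lemma square_expectation_le:
  fixes f :: "'a \<Rightarrow> real"
  assumes [measurable]: "f \<in> borel_measurable M" and "integrable M (\<lambda>y. (f y)\<^sup>2)"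
  shows "(expectation f)\<^sup>2 \<le> expectation (\<lambda>y. (f y)\<^sup>2)"
proof -
  have "0 \<le> expectation (\<lambda>y. (f y - expectation f)\<^sup>2)" by simp
  also have "\<dots> = expectation (\<lambda>y. (f y)\<^sup>2) - (expectation f)\<^sup>2"
    using assms square_integrable_imp_integrable[OF assms] by (intro variance_eq)
  finally show ?thesis by simp
qed

section \<open>A maximal inequality from the log-sum-exp potential\<close>

text \<open>In \<open>ln_sum_exp_add_le\<close> the linear term has mean zero, as the increments are
  centred. Centring enlarges the envelope to \<open>G\<close> plus its mean, whose second moment is
  at most four times that of \<open>G\<close>; half of it gives the factor 2.\<close>

lemma expectation_ln_sum_exp_step:
  fixes g :: "'i \<Rightarrow> 'a \<Rightarrow> real"
  assumes I: "finite I" "I \<noteq> {}"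
    and g[measurable]: "\<And>i. i \<in> I \<Longrightarrow> g i \<in> borel_measurable M"
    and G[measurable]: "G \<in> borel_measurable M"
    and gG: "\<And>i y. i \<in> I \<Longrightarrow> y \<in> space M \<Longrightarrow> \<bar>g i y\<bar> \<le> G y"
    and G2: "integrable M (\<lambda>y. (G y)\<^sup>2)"
  shows "integrable M (\<lambda>y. ln (\<Sum>i\<in>I. exp (v i + (g i y - expectation (g i)))))"
    and "expectation (\<lambda>y. ln (\<Sum>i\<in>I. exp (v i + (g i y - expectation (g i)))))
    \<le> ln (\<Sum>i\<in>I. exp (v i)) + 2 * expectation (\<lambda>y. (G y)\<^sup>2)"
proof -
  have Gi: "integrable M G" using square_integrable_imp_integrable[OF G G2] .
  have gi: "integrable M (g i)" if "i \<in> I" for i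
    using integrable_real_bound[OF Gi g[OF that] gG[OF that]] .
  let ?e = "expectation G"
  have x: "\<bar>g i y - expectation (g i)\<bar> \<le> G y + ?e" if "i \<in> I" "y \<in> space M" for i y
  proof -
    have "\<bar>expectation (g i)\<bar> \<le> expectation (\<lambda>y. \<bar>g i y\<bar>)" by (rule integral_abs_bound)
    also have "\<dots> \<le> ?e" using gi Gi gG that by (intro integral_mono) auto
    finally show ?thesis using gG[OF that] by linarith
  qed
  let ?p = "\<lambda>i. exp (v i) / (\<Sum>i\<in>I. exp (v i))"
  let ?R = "\<lambda>y. ln (\<Sum>i\<in>I. exp (v i)) + (\<Sum>i\<in>I. ?p i * (g i y - expectation (g i))) + (G y + ?e)\<^sup>2 / 2"
  have sq: "(G y + ?e)\<^sup>2 = (G y)\<^sup>2 + 2 * ?e * G y + ?e\<^sup>2" for y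
    by (simp add: power2_sum algebra_simps)
  show int: "integrable M (\<lambda>y. ln (\<Sum>i\<in>I. exp (v i + (g i y - expectation (g i)))))"
  proof (rule Bochner_Integration.integrable_bound)
    show "integrable M (\<lambda>y. ln (card I) + (\<Sum>i\<in>I. \<bar>v i + (g i y - expectation (g i))\<bar>))"
      using gi by auto
  qed (auto intro!: AE_I2 order_trans[OF abs_ln_sum_exp_le[OF I] abs_ge_self])
  have "expectation (\<lambda>y. ln (\<Sum>i\<in>I. exp (v i + (g i y - expectation (g i))))) \<le> expectation ?R"
  proof (rule integral_mono)
    show "integrable M (\<lambda>y. ln (\<Sum>i\<in>I. exp (v i + (g i y - expectation (g i)))))" by (rule int)
    show "integrable M ?R"
      unfolding sq using gi Gi G2 by auto
    show "ln (\<Sum>i\<in>I. exp (v i + (g i y - expectation (g i)))) \<le> ?R y" if "y \<in> space M" for y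
      using x that by (intro ln_sum_exp_add_le I) auto
  qed
  also have "expectation ?R = ln (\<Sum>i\<in>I. exp (v i)) + expectation (\<lambda>y. (G y + ?e)\<^sup>2) / 2"
    using gi Gi G2 by (simp add: sq prob_space)
  also have "expectation (\<lambda>y. (G y + ?e)\<^sup>2) = expectation (\<lambda>y. (G y)\<^sup>2) + 3 * ?e\<^sup>2"
    unfolding sq using Gi G2 by (simp add: prob_space power2_eq_square)
  also have "\<dots> \<le> 4 * expectation (\<lambda>y. (G y)\<^sup>2)"
    using square_expectation_le[OF G G2] by simp
  finally show "expectation (\<lambda>y. ln (\<Sum>i\<in>I. exp (v i + (g i y - expectation (g i)))))
      \<le> ln (\<Sum>i\<in>I. exp (v i)) + 2 * expectation (\<lambda>y. (G y)\<^sup>2)" by simp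
qed

text \<open>The potential starts at \<open>ln (card I)\<close> for the empty sum, and each new
  sample raises its mean by a fixed amount, whatever the earlier samples are.\<close>

lemma expectation_ln_sum_exp_le:
  fixes g :: "'i \<Rightarrow> 'a \<Rightarrow> real"
  assumes I: "finite I" "I \<noteq> {}" and J: "finite J"
    and g[measurable]: "\<And>i. i \<in> I \<Longrightarrow> g i \<in> borel_measurable M"
    and G[measurable]: "G \<in> borel_measurable M"
    and gG: "\<And>i y. i \<in> I \<Longrightarrow> y \<in> space M \<Longrightarrow> \<bar>g i y\<bar> \<le> G y"
    and G2: "integrable M (\<lambda>y. (G y)\<^sup>2)"
  defines "\<Psi> \<equiv> \<lambda>J W. ln (\<Sum>i\<in>I. exp (\<Sum>j\<in>J. g i (W j) - expectation (g i)))"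
  shows "integrable (PiM J (\<lambda>_. M)) (\<Psi> J)"
    and "(\<integral>W. \<Psi> J W \<partial>PiM J (\<lambda>_. M)) \<le> ln (real (card I)) + card J * (2 * expectation (\<lambda>y. (G y)\<^sup>2))"
proof -
  have Gi: "integrable M G" using square_integrable_imp_integrable[OF G G2] .
  have gi: "integrable M (g i)" if "i \<in> I" for i
    using integrable_real_bound[OF Gi g[OF that] gG[OF that]] .
  interpret prod: product_prob_space "\<lambda>_. M" UNIV by unfold_locales
  have P: "prob_space (PiM J (\<lambda>_. M))" for J :: "'b set"
    by (intro prob_space_PiM) unfold_locales
  have int: "integrable (PiM J (\<lambda>_. M)) (\<Psi> J)" if "finite J" for J
  proof (rule Bochner_Integration.integrable_bound)
    interpret PJ: prob_space "PiM J (\<lambda>_. M)" by (rule P)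
    show "integrable (PiM J (\<lambda>_. M)) (\<lambda>W. ln (card I) + (\<Sum>i\<in>I. \<bar>\<Sum>j\<in>J. g i (W j) - expectation (g i)\<bar>))"
      using integrable_PiM_component[OF _ gi, of _ J] by auto
    show "\<Psi> J \<in> borel_measurable (PiM J (\<lambda>_. M))"
      unfolding \<Psi>_def using borel_measurable_integrable[OF integrable_PiM_component[OF _ gi, of _ J]] by auto
  qed (auto intro!: AE_I2 order_trans[OF abs_ln_sum_exp_le[OF I] abs_ge_self] simp: \<Psi>_def)
  show "integrable (PiM J (\<lambda>_. M)) (\<Psi> J)" using int[OF J] .
  show "(\<integral>W. \<Psi> J W \<partial>PiM J (\<lambda>_. M)) \<le> ln (real (card I)) + card J * (2 * expectation (\<lambda>y. (G y)\<^sup>2))"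
    using J
  proof (induction J rule: finite_induct)
    case empty
    interpret PJ: prob_space "PiM {} (\<lambda>_::'b. M)" by (rule P)
    show ?case using I by (simp add: \<Psi>_def PJ.prob_space)
  next
    case (insert j J)
    interpret PJ: prob_space "PiM J (\<lambda>_. M)" by (rule P)
    let ?c = "2 * expectation (\<lambda>y. (G y)\<^sup>2)"
    have sum: "(\<Sum>k\<in>insert j J. g i ((W(j := y)) k) - expectation (g i)) =
        (\<Sum>k\<in>J. g i (W k) - expectation (g i)) + (g i y - expectation (g i))" for i W y
    proof -
      have "(\<Sum>k\<in>J. g i ((W(j := y)) k) - expectation (g i)) = (\<Sum>k\<in>J. g i (W k) - expectation (g i))"
        using insert.hyps by (intro sum.cong) auto
      then show ?thesis using insert.hyps by simp
    qed
    have "(\<integral>W. \<Psi> (insert j J) W \<partial>PiM (insert j J) (\<lambda>_. M)) =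
        (\<integral>W. expectation (\<lambda>y. \<Psi> (insert j J) (W(j := y))) \<partial>PiM J (\<lambda>_. M))"
      using insert.hyps int[of "insert j J"] by (intro prod.product_integral_insert) auto
    also have "\<dots> \<le> (\<integral>W. \<Psi> J W + ?c \<partial>PiM J (\<lambda>_. M))"
    proof (rule integral_mono)
      show "integrable (PiM J (\<lambda>_. M)) (\<lambda>W. expectation (\<lambda>y. \<Psi> (insert j J) (W(j := y))))"
      proof (rule integrable_expectation_update[OF insert.hyps])
        show "integrable (PiM (insert j J) (\<lambda>_. M)) (\<Psi> (insert j J))"
          using insert.hyps by (intro int) auto
        show "integrable M (\<lambda>y. \<Psi> (insert j J) (W(j := y)))" for W
          unfolding \<Psi>_def sum by (rule expectation_ln_sum_exp_step(1)[OF I g G gG G2])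
      qed
      show "expectation (\<lambda>y. \<Psi> (insert j J) (W(j := y))) \<le> \<Psi> J W + ?c" for W
        unfolding \<Psi>_def sum by (rule expectation_ln_sum_exp_step(2)[OF I g G gG G2])
    qed (use int[OF insert.hyps(1)] in auto)
    also have "\<dots> = (\<integral>W. \<Psi> J W \<partial>PiM J (\<lambda>_. M)) + ?c"
      using int[OF insert.hyps(1)] by (simp add: PJ.prob_space)
    finally show ?case
      using insert by (simp add: algebra_simps)
  qed
qed

lemma integrable_Max_abs_sum:
  fixes g :: "'i \<Rightarrow> 'a \<Rightarrow> real"
  assumes I: "finite I" "I \<noteq> {}" and "finite J" and gi: "\<And>i. i \<in> I \<Longrightarrow> integrable M (g i)"
  shows "integrable (PiM J (\<lambda>_. M)) (\<lambda>W. Max ((\<lambda>i. \<bar>\<Sum>j\<in>J. g i (W j) - expectation (g i)\<bar>) ` I))"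
proof -
  interpret PJ: prob_space "PiM J (\<lambda>_. M)"
    by (intro prob_space_PiM) unfold_locales
  let ?X = "\<lambda>i W. \<bar>\<Sum>j\<in>J. g i (W j) - expectation (g i)\<bar>"
  have X: "integrable (PiM J (\<lambda>_. M)) (?X i)" if "i \<in> I" for i
    using integrable_PiM_component[OF _ gi[OF that], of _ J] by auto
  show ?thesis
  proof (rule Bochner_Integration.integrable_bound)
    show "integrable (PiM J (\<lambda>_. M)) (\<lambda>W. \<Sum>i\<in>I. ?X i W)"
      using X by auto
    show "(\<lambda>W. Max ((\<lambda>i. ?X i W) ` I)) \<in> borel_measurable (PiM J (\<lambda>_. M))"
      using X I by (intro borel_measurable_Max) auto
    have "\<bar>Max ((\<lambda>i. ?X i W) ` I)\<bar> \<le> (\<Sum>i\<in>I. ?X i W)" for W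
    proof -
      have "Max ((\<lambda>i. ?X i W) ` I) \<in> (\<lambda>i. ?X i W) ` I"
        using I by (intro Max_in) auto
      then obtain i where "i \<in> I" "Max ((\<lambda>i. ?X i W) ` I) = ?X i W" by blast
      then show ?thesis using I member_le_sum[of i I "\<lambda>i. ?X i W"] by simp
    qed
    then show "AE W in PiM J (\<lambda>_. M). norm (Max ((\<lambda>i. ?X i W) ` I)) \<le> norm (\<Sum>i\<in>I. ?X i W)"
      by (intro AE_I2) (auto intro: order_trans)
  qed
qed

text \<open>The potential of the functions \<open>g i\<close> scaled by \<open>l\<close> and by
  \<open>- l\<close> dominates \<open>l\<close> times the maximum of absolute values. The two signs
  double the index set, hence \<open>2 * card I\<close>.\<close>

lemma expectation_Max_abs_sum_le:
  fixes g :: "'i \<Rightarrow> 'a \<Rightarrow> real"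
  assumes I: "finite I" "I \<noteq> {}" and J: "finite J" "J \<noteq> {}"
    and g[measurable]: "\<And>i. i \<in> I \<Longrightarrow> g i \<in> borel_measurable M"
    and G[measurable]: "G \<in> borel_measurable M"
    and gG: "\<And>i y. i \<in> I \<Longrightarrow> y \<in> space M \<Longrightarrow> \<bar>g i y\<bar> \<le> G y"
    and G2: "integrable M (\<lambda>y. (G y)\<^sup>2)" "expectation (\<lambda>y. (G y)\<^sup>2) \<le> h\<^sup>2" "h > 0"
  shows "(\<integral>W. Max ((\<lambda>i. \<bar>\<Sum>j\<in>J. g i (W j) - expectation (g i)\<bar>) ` I) \<partial>PiM J (\<lambda>_. M))
    \<le> 2 * h * sqrt (2 * card J * ln (2 * card I))"
proof -
  define m where "m = real (card J)"
  define L where "L = ln (2 * real (card I))"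
  have m: "m > 0" using J by (simp add: m_def card_gt_0_iff)
  have cI: "real (card I) \<ge> 1" using I by (simp add: Suc_le_eq card_gt_0_iff)
  then have L: "L > 0" unfolding L_def by (intro ln_gt_zero) linarith
  \<comment> \<open>This scale balances the two terms of the bound:
    \<open>2 * m * l\<^sup>2 * h\<^sup>2 = L\<close>.\<close>
  define l where "l = sqrt (L / (2 * m)) / h"
  have l: "l > 0" using L m G2 by (simp add: l_def)
  define g' where "g' = (\<lambda>(i, b) y. (if b then l else - l) * g i y)"
  let ?X = "\<lambda>i W. \<Sum>j\<in>J. g i (W j) - expectation (g i)"
  let ?I = "I \<times> (UNIV :: bool set)"
  let ?\<Psi> = "\<lambda>W. ln (\<Sum>i\<in>?I. exp (\<Sum>j\<in>J. g' i (W j) - expectation (g' i)))"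
  have I': "finite ?I" "?I \<noteq> {}" using I by auto
  have cI': "real (card ?I) = 2 * real (card I)" by (simp add: card_cartesian_product)
  have g'm: "g' i \<in> borel_measurable M" if "i \<in> ?I" for i
    using that by (auto simp: g'_def)
  have lGm: "(\<lambda>y. l * G y) \<in> borel_measurable M" by simp
  have g'G: "\<bar>g' i y\<bar> \<le> l * G y" if "i \<in> ?I" "y \<in> space M" for i y
    using that gG l by (auto simp: g'_def abs_mult)
  have lG2: "integrable M (\<lambda>y. (l * G y)\<^sup>2)"
    using G2 by (simp add: power_mult_distrib)
  note le = expectation_ln_sum_exp_le[OF I' J(1) g'm lGm g'G lG2]
  have Gi: "integrable M G" using square_integrable_imp_integrable[OF G G2(1)] .
  have gi: "integrable M (g i)" if "i \<in> I" for i
    using integrable_real_bound[OF Gi g[OF that] gG[OF that]] .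
  have "(\<integral>W. l * Max ((\<lambda>i. \<bar>?X i W\<bar>) ` I) \<partial>PiM J (\<lambda>_. M)) \<le> (\<integral>W. ?\<Psi> W \<partial>PiM J (\<lambda>_. M))"
  proof (rule integral_mono)
    show "integrable (PiM J (\<lambda>_. M)) (\<lambda>W. l * Max ((\<lambda>i. \<bar>?X i W\<bar>) ` I))"
      using integrable_Max_abs_sum[OF I J(1) gi] by simp
    show "integrable (PiM J (\<lambda>_. M)) ?\<Psi>" by (rule le(1))
    fix W
    have "Max ((\<lambda>i. \<bar>?X i W\<bar>) ` I) \<in> (\<lambda>i. \<bar>?X i W\<bar>) ` I"
      using I by (intro Max_in) auto
    then obtain i where i: "i \<in> I" "Max ((\<lambda>i. \<bar>?X i W\<bar>) ` I) = \<bar>?X i W\<bar>" by blast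
    have s: "(\<Sum>j\<in>J. g' (i, b) (W j) - expectation (g' (i, b))) = (if b then l else - l) * ?X i W" for b
      by (simp add: g'_def sum_distrib_left right_diff_distrib)
    \<comment> \<open>The Boolean component is chosen as the sign of the sum, which realises the
      absolute value.\<close>
    have "l * \<bar>?X i W\<bar> = (\<Sum>j\<in>J. g' (i, 0 \<le> ?X i W) (W j) - expectation (g' (i, 0 \<le> ?X i W)))"
      unfolding s by simp
    also have "\<dots> \<le> ?\<Psi> W"
      using i I' ln_sum_exp_ge[OF I'(1), of "(i, 0 \<le> ?X i W)" "\<lambda>i. \<Sum>j\<in>J. g' i (W j) - expectation (g' i)"]
      by simp
    finally show "l * Max ((\<lambda>i. \<bar>?X i W\<bar>) ` I) \<le> ?\<Psi> W" using i by simp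
  qed
  also have "\<dots> \<le> L + m * (2 * expectation (\<lambda>y. (l * G y)\<^sup>2))"
    using le(2) unfolding L_def m_def cI' .
  also have "\<dots> \<le> L + m * (2 * (l\<^sup>2 * h\<^sup>2))"
    using G2 m by (simp add: power_mult_distrib mult_left_mono)
  also have "\<dots> = 2 * L"
    using m L G2 by (simp add: l_def power_divide)
  also have "\<dots> = l * (2 * h * sqrt (2 * m * L))"
    using m L G2 by (simp add: l_def flip: real_sqrt_mult)
  finally show ?thesis
    using l by (simp add: m_def L_def)
qed

section \<open>Exponential moments\<close>

text \<open>The case \<open>n = 2\<close> of the Bernstein condition; \<open>2 - 2\<close> is left
  unevaluated to fit the instance.\<close>

lemma second_moment_le_one:
  fixes H :: "'a \<Rightarrow> real"
  assumes [measurable]: "H \<in> borel_measurable M"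
    and "(\<integral>\<^sup>+y. ennreal (H y ^ 2) \<partial>M) \<le> ennreal (fact 2 / 2 * K ^ (2 - 2))"
  shows "integrable M (\<lambda>y. (H y)\<^sup>2)" "expectation (\<lambda>y. (H y)\<^sup>2) \<le> 1"
proof -
  have le: "(\<integral>\<^sup>+y. ennreal ((H y)\<^sup>2) \<partial>M) \<le> 1" using assms(2) by simp
  show *: "integrable M (\<lambda>y. (H y)\<^sup>2)"
    using le by (intro integrableI_nonneg) (auto simp: order_le_less_trans[OF _ ennreal_one_less_top])
  show "expectation (\<lambda>y. (H y)\<^sup>2) \<le> 1"
    using le by (subst (asm) nn_integral_eq_integral[OF *]) auto
qed

text \<open>Averaging the oscillation bound over \<open>y'\<close> gives
  \<open>\<bar>a y - expectation a\<bar> \<le> \<theta> * (H y + 1)\<close>. The exponential series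
  of the centred variable loses its linear term on integration, and the Bernstein condition
  dominates the rest by a geometric series of ratio \<open>2 * \<theta> * K\<close>.\<close>

lemma exp_moment_bernstein:
  fixes H :: "'a \<Rightarrow> real"
  assumes [measurable]: "H \<in> borel_measurable M" and H0: "\<And>y. y \<in> space M \<Longrightarrow> 0 \<le> H y"
    and mom: "\<And>n::nat. n \<ge> 2 \<Longrightarrow> (\<integral>\<^sup>+y. ennreal (H y ^ n) \<partial>M) \<le> ennreal (fact n / 2 * K ^ (n - 2))"
    and K: "K \<ge> 1" and \<theta>: "\<theta> \<ge> 0" "2 * \<theta> * K < 1"
    and a[measurable]: "a \<in> borel_measurable M"
    and diff: "\<And>y y'. y \<in> space M \<Longrightarrow> y' \<in> space M \<Longrightarrow> \<bar>a y - a y'\<bar> \<le> \<theta> * (H y + H y')"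
  shows "integrable M a"
    and "(\<integral>\<^sup>+y. ennreal (exp (a y)) \<partial>M) \<le> ennreal (exp (expectation a + 4 * \<theta>\<^sup>2 / (1 - 2 * \<theta> * K)))"
proof -
  have H2: "integrable M (\<lambda>y. (H y)\<^sup>2)" "expectation (\<lambda>y. (H y)\<^sup>2) \<le> 1"
    using second_moment_le_one[OF _ mom[of 2]] by auto
  \<comment> \<open>This turns the second moment bound into integrability of \<open>H\<close> with
    mean at most 1.\<close>
  have Hle: "\<bar>H y\<bar> \<le> (1 + (H y)\<^sup>2) / 2" for y
    using zero_le_power2[of "\<bar>H y\<bar> - 1"] by (simp add: power2_diff)
  have Hi: "integrable M H"
    by (rule Bochner_Integration.integrable_bound[of M "\<lambda>y. (1 + (H y)\<^sup>2) / 2"])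
      (use H2 Hle in \<open>auto intro!: AE_I2 intro: order_trans\<close>)
  have "expectation H \<le> expectation (\<lambda>y. (1 + (H y)\<^sup>2) / 2)"
    using H2 Hi order_trans[OF abs_ge_self Hle] by (intro integral_mono) auto
  also have "\<dots> \<le> 1" using H2 by (simp add: prob_space)
  finally have EH: "expectation H \<le> 1" .
  obtain y0 where y0: "y0 \<in> space M" using not_empty by blast
  show ai: "integrable M a"
  proof (rule Bochner_Integration.integrable_bound[of M "\<lambda>y. \<bar>a y0\<bar> + \<theta> * (H y + H y0)"])
    show "AE y in M. norm (a y) \<le> norm (\<bar>a y0\<bar> + \<theta> * (H y + H y0))"
    proof (rule AE_I2)
      fix y assume "y \<in> space M"
      then show "norm (a y) \<le> norm (\<bar>a y0\<bar> + \<theta> * (H y + H y0))"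
        using diff[OF \<open>y \<in> space M\<close> y0] by simp
    qed
  qed (use Hi in auto)
  define u where "u y = \<theta> * (H y + 1)" for y
  have u: "\<bar>a y - expectation a\<bar> \<le> u y" if y: "y \<in> space M" for y
  proof -
    have "a y - expectation a = expectation (\<lambda>y'. a y - a y')"
      using ai by (simp add: prob_space)
    also have "\<bar>\<dots>\<bar> \<le> expectation (\<lambda>y'. \<bar>a y - a y'\<bar>)"
      by (rule integral_abs_bound)
    also have "\<dots> \<le> expectation (\<lambda>y'. \<theta> * (H y + H y'))"
      using diff y ai Hi by (intro integral_mono) auto
    also have "\<dots> = \<theta> * (H y + expectation H)"
      using Hi by (simp add: prob_space)
    also have "\<dots> \<le> u y" unfolding u_def using EH \<theta> by (intro mult_left_mono) auto
    finally show ?thesis .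
  qed
  have u0: "0 \<le> u y" if "y \<in> space M" for y using u[OF that] by linarith
  have [measurable]: "u \<in> borel_measurable M" unfolding u_def by simp
  let ?Y = "\<lambda>y. a y - expectation a"
  let ?r = "2 * \<theta> * K"
  \<comment> \<open>Nonnegative extended reals allow exchanging series and integral before the
    exponential is known to be integrable.\<close>
  have ptw: "ennreal (exp (?Y y) - 1 - ?Y y) \<le> (\<Sum>n. ennreal (u y ^ (n + 2) / fact (n + 2)))"
    if y: "y \<in> space M" for y
  proof -
    have S: "summable (\<lambda>n. inverse (fact (n + 2)) * x ^ (n + 2))" for x :: real
      using summable_ignore_initial_segment[OF summable_exp, of 2 x] by simp
    have "exp (?Y y) - 1 - ?Y y = (\<Sum>n. inverse (fact (n + 2)) * ?Y y ^ (n + 2))"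
      using exp_first_two_terms[of "?Y y"] by (simp add: scaleR_conv_of_real)
    also have "\<dots> \<le> (\<Sum>n. inverse (fact (n + 2)) * u y ^ (n + 2))"
    proof (intro suminf_le S mult_left_mono)
      fix n
      have "?Y y ^ (n + 2) \<le> \<bar>?Y y\<bar> ^ (n + 2)" by (simp add: power_abs[symmetric] del: power_Suc)
      also have "\<dots> \<le> u y ^ (n + 2)" using u[OF y] by (intro power_mono) auto
      finally show "?Y y ^ (n + 2) \<le> u y ^ (n + 2)" .
    qed simp
    finally have "exp (?Y y) - 1 - ?Y y \<le> (\<Sum>n. u y ^ (n + 2) / fact (n + 2))"
      by (simp add: field_simps)
    then have "ennreal (exp (?Y y) - 1 - ?Y y) \<le> ennreal (\<Sum>n. u y ^ (n + 2) / fact (n + 2))"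
      by (rule ennreal_leI)
    also have "\<dots> = (\<Sum>n. ennreal (u y ^ (n + 2) / fact (n + 2)))"
      using S[of "u y"] u0[OF y] by (intro suminf_ennreal2[symmetric]) (auto simp: field_simps)
    finally show ?thesis .
  qed
  \<comment> \<open>From \<open>(H y + 1) ^ N \<le> 2 ^ N * (H y ^ N + 1)\<close> with
    \<open>N = n + 2\<close>. The additional 1 is absorbed by doubling the moment bound, since
    \<open>fact N / 2 * K ^ n \<ge> 1\<close>; the factorials then cancel.\<close>
  have tm: "(\<integral>\<^sup>+y. ennreal (u y ^ (n + 2) / fact (n + 2)) \<partial>M) \<le> ennreal (4 * \<theta>\<^sup>2 * ?r ^ n)" for n
  proof -
    let ?N = "n + 2"
    define b where "b = (2 * \<theta>) ^ ?N / fact ?N"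
    have b: "b \<ge> 0" using \<theta> by (simp add: b_def)
    have "(H y + 1) ^ ?N \<le> 2 ^ ?N * (H y ^ ?N + 1)" if "y \<in> space M" for y
    proof (cases "H y \<le> 1")
      case True
      then have "(H y + 1) ^ ?N \<le> 2 ^ ?N" using H0[OF that] by (intro power_mono) auto
      also have "\<dots> \<le> 2 ^ ?N * (H y ^ ?N + 1)" using H0[OF that] by simp
      finally show ?thesis .
    next
      case False
      then have "(H y + 1) ^ ?N \<le> (2 * H y) ^ ?N" using H0[OF that] by (intro power_mono) auto
      also have "\<dots> \<le> 2 ^ ?N * (H y ^ ?N + 1)" by (simp add: power_mult_distrib algebra_simps)
      finally show ?thesis .
    qed
    then have "\<theta> ^ ?N * (H y + 1) ^ ?N / fact ?N \<le> \<theta> ^ ?N * (2 ^ ?N * (H y ^ ?N + 1)) / fact ?N"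
      if "y \<in> space M" for y
      using that \<theta> by (intro divide_right_mono mult_left_mono) auto
    then have *: "u y ^ ?N / fact ?N \<le> b * (H y ^ ?N + 1)" if "y \<in> space M" for y
      using that unfolding u_def b_def power_mult_distrib by (simp add: mult_ac)
    have "(\<integral>\<^sup>+y. ennreal (u y ^ ?N / fact ?N) \<partial>M) \<le> (\<integral>\<^sup>+y. ennreal b * (ennreal (H y ^ ?N) + 1) \<partial>M)"
    proof (rule nn_integral_mono)
      fix y assume y: "y \<in> space M"
      have "ennreal (u y ^ ?N / fact ?N) \<le> ennreal (b * (H y ^ ?N + 1))"
        using *[OF y] by (rule ennreal_leI)
      also have "\<dots> = ennreal b * (ennreal (H y ^ ?N) + 1)"
        using H0[OF y] b by (simp add: ennreal_mult del: power_Suc)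
      finally show "ennreal (u y ^ ?N / fact ?N) \<le> ennreal b * (ennreal (H y ^ ?N) + 1)" .
    qed
    also have "\<dots> = ennreal b * ((\<integral>\<^sup>+y. ennreal (H y ^ ?N) \<partial>M) + 1)"
      by (simp add: nn_integral_cmult nn_integral_add emeasure_space_1)
    also have "\<dots> \<le> ennreal b * (ennreal (fact ?N / 2 * K ^ n) + 1)"
      using mom[of ?N] by (intro mult_left_mono add_right_mono) auto
    also have "\<dots> = ennreal (b * (fact ?N / 2 * K ^ n + 1))"
      using b K by (simp add: ennreal_mult ennreal_plus del: power_Suc fact_Suc)
    also have "\<dots> \<le> ennreal (b * (fact ?N * K ^ n))"
    proof (intro ennreal_leI mult_left_mono b)
      have "fact 2 \<le> (fact ?N :: real)" by (intro fact_mono) auto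
      then have "1 * 1 \<le> (fact ?N / 2) * K ^ n"
        using K by (intro mult_mono one_le_power) (auto simp del: fact_Suc)
      then show "fact ?N / 2 * K ^ n + 1 \<le> fact ?N * K ^ n" by simp
    qed
    also have "b * (fact ?N * K ^ n) = 4 * \<theta>\<^sup>2 * ?r ^ n"
      by (simp add: b_def power_mult_distrib power_add power2_eq_square del: fact_Suc)
    finally show ?thesis .
  qed
  have r: "0 \<le> ?r" "?r < 1" using \<theta> K by auto
  let ?c = "4 * \<theta>\<^sup>2 / (1 - ?r)"
  have "(\<integral>\<^sup>+y. ennreal (exp (?Y y) - 1 - ?Y y) \<partial>M) \<le> (\<integral>\<^sup>+y. (\<Sum>n. ennreal (u y ^ (n + 2) / fact (n + 2))) \<partial>M)"
    using ptw by (rule nn_integral_mono)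
  also have "\<dots> = (\<Sum>n. \<integral>\<^sup>+y. ennreal (u y ^ (n + 2) / fact (n + 2)) \<partial>M)"
    by (intro nn_integral_suminf) simp
  also have "\<dots> \<le> (\<Sum>n. ennreal (4 * \<theta>\<^sup>2 * ?r ^ n))"
    using tm by (intro suminf_le) auto
  also have "\<dots> = ennreal (\<Sum>n. 4 * \<theta>\<^sup>2 * ?r ^ n)"
    using r by (intro suminf_ennreal2) (auto intro!: summable_mult summable_geometric)
  also have "(\<Sum>n. 4 * \<theta>\<^sup>2 * ?r ^ n) = ?c"
    using r by (simp add: suminf_mult suminf_geometric summable_geometric)
  finally have le: "(\<integral>\<^sup>+y. ennreal (exp (?Y y) - 1 - ?Y y) \<partial>M) \<le> ennreal ?c" .
  have nn: "0 \<le> exp (?Y y) - 1 - ?Y y" for y using exp_ge_add_one_self[of "?Y y"] by linarith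
  have i1: "integrable M (\<lambda>y. exp (?Y y) - 1 - ?Y y)"
    using le nn by (intro integrableI_nonneg) (auto simp: order_le_less_trans)
  have "integrable M (\<lambda>y. (exp (?Y y) - 1 - ?Y y) + (1 + ?Y y))"
    using i1 ai by (intro Bochner_Integration.integrable_add) auto
  then have i2: "integrable M (\<lambda>y. exp (?Y y))" by simp
  have "0 \<le> ?c" using r by simp
  then have "expectation (\<lambda>y. exp (?Y y) - 1 - ?Y y) \<le> ?c"
    using le nn by (subst (asm) nn_integral_eq_integral[OF i1]) auto
  moreover have "expectation (\<lambda>y. exp (?Y y) - 1 - ?Y y) = expectation (\<lambda>y. exp (?Y y)) - 1"
    using i2 ai by (simp add: prob_space)
  ultimately have "expectation (\<lambda>y. exp (?Y y)) \<le> exp ?c"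
    using exp_ge_add_one_self[of ?c] by linarith
  then have le2: "(\<integral>\<^sup>+y. ennreal (exp (?Y y)) \<partial>M) \<le> ennreal (exp ?c)"
    by (subst nn_integral_eq_integral[OF i2]) (auto intro: ennreal_leI)
  have "(\<integral>\<^sup>+y. ennreal (exp (a y)) \<partial>M) = (\<integral>\<^sup>+y. ennreal (exp (expectation a)) * ennreal (exp (?Y y)) \<partial>M)"
    by (intro nn_integral_cong) (simp flip: ennreal_mult exp_add)
  also have "\<dots> = ennreal (exp (expectation a)) * (\<integral>\<^sup>+y. ennreal (exp (?Y y)) \<partial>M)"
    by (intro nn_integral_cmult) simp
  also have "\<dots> \<le> ennreal (exp (expectation a)) * ennreal (exp ?c)"
    using le2 by (intro mult_left_mono) auto
  finally show "(\<integral>\<^sup>+y. ennreal (exp (a y)) \<partial>M) \<le> ennreal (exp (expectation a + ?c))"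
    by (simp add: exp_add ennreal_mult)
qed

text \<open>Samples are integrated out one at a time. Averaging over one coordinate preserves the
  bounded differences in the others, so every stage costs the same factor \<open>exp c\<close>. The
  assumption \<open>step\<close> abstracts the bound for a single coordinate.\<close>

lemma exp_moment_PiM:
  fixes H :: "'a \<Rightarrow> real" and c :: real
  assumes step: "\<And>a. a \<in> borel_measurable M \<Longrightarrow>
        (\<And>y y'. y \<in> space M \<Longrightarrow> y' \<in> space M \<Longrightarrow> \<bar>a y - a y'\<bar> \<le> H y + H y') \<Longrightarrow>
        integrable M a \<and> (\<integral>\<^sup>+y. ennreal (exp (a y)) \<partial>M) \<le> ennreal (exp (expectation a + c))"
    and "finite J" and "integrable (PiM J (\<lambda>_. M)) F"
    and "\<And>W j y y'. W \<in> space (PiM J (\<lambda>_. M)) \<Longrightarrow> j \<in> J \<Longrightarrow> y \<in> space M \<Longrightarrow> y' \<in> space M \<Longrightarrow>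
        \<bar>F (W(j := y)) - F (W(j := y'))\<bar> \<le> H y + H y'"
  shows "(\<integral>\<^sup>+W. ennreal (exp (F W)) \<partial>PiM J (\<lambda>_. M)) \<le>
    ennreal (exp ((\<integral>W. F W \<partial>PiM J (\<lambda>_. M)) + card J * c))"
  using assms(2-)
proof (induction J arbitrary: F rule: finite_induct)
  case empty
  then show ?case
    by (simp add: PiM_empty nn_integral_count_space_finite lebesgue_integral_count_space_finite)
next
  case (insert j J)
  \<comment> \<open>The difference hypothesis needs a point of the larger product; \<open>y0\<close>
    fills coordinate \<open>j\<close> and is overwritten at once.\<close>
  obtain y0 where y0: "y0 \<in> space M" using not_empty by blast
  interpret prod: product_prob_space "\<lambda>_. M" UNIV by unfold_locales
  have sp: "W(j := y) \<in> space (PiM (insert j J) (\<lambda>_. M))"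
    if "W \<in> space (PiM J (\<lambda>_. M))" "y \<in> space M" for W y
    using that by (auto simp: space_PiM PiE_iff extensional_def)
  have sp': "W(i := y) \<in> space (PiM J (\<lambda>_. M))"
    if "W \<in> space (PiM J (\<lambda>_. M))" "i \<in> J" "y \<in> space M" for W i y
    using that by (auto simp: space_PiM PiE_iff extensional_def)
  have Fm[measurable]: "F \<in> borel_measurable (PiM (insert j J) (\<lambda>_. M))"
    using insert.prems by auto
  have upd[measurable]: "(\<lambda>(W, y). F (W(j := y))) \<in> borel_measurable (PiM J (\<lambda>_. M) \<Otimes>\<^sub>M M)"
    using measurable_compose[OF measurable_add_dim[of j J "\<lambda>_. M"] Fm] by (simp add: case_prod_beta)
  have updW: "(\<lambda>y. F (W(j := y))) \<in> borel_measurable M" if "W \<in> space (PiM J (\<lambda>_. M))" for W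
    using measurable_compose[OF measurable_Pair1'[OF that] upd] by simp
  have one: "integrable M (\<lambda>y. F (W(j := y)))"
    "(\<integral>\<^sup>+y. ennreal (exp (F (W(j := y)))) \<partial>M) \<le> ennreal (exp (expectation (\<lambda>y. F (W(j := y))) + c))"
    if W: "W \<in> space (PiM J (\<lambda>_. M))" for W
  proof -
    have "\<bar>F (W(j := y)) - F (W(j := y'))\<bar> \<le> H y + H y'" if "y \<in> space M" "y' \<in> space M" for y y'
      using insert.prems(2)[OF sp[OF W y0], of j y y'] that by (simp only: fun_upd_upd insertI1)
    with step[OF updW[OF W]]
    show "integrable M (\<lambda>y. F (W(j := y)))"
      "(\<integral>\<^sup>+y. ennreal (exp (F (W(j := y)))) \<partial>M) \<le> ennreal (exp (expectation (\<lambda>y. F (W(j := y))) + c))"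
      by auto
  qed
  let ?F = "\<lambda>W. expectation (\<lambda>y. F (W(j := y)))"
  have F'i: "integrable (PiM J (\<lambda>_. M)) ?F"
    by (rule integrable_expectation_update[OF insert.hyps insert.prems(1) one(1)])
  have F'd: "\<bar>?F (W(i := y)) - ?F (W(i := y'))\<bar> \<le> H y + H y'"
    if W: "W \<in> space (PiM J (\<lambda>_. M))" and i: "i \<in> J" and y: "y \<in> space M" "y' \<in> space M" for W i y y'
  proof -
    have ij: "i \<noteq> j" using i insert.hyps by auto
    note ints = one(1)[OF sp'[OF W i y(1)]] one(1)[OF sp'[OF W i y(2)]]
    have "\<bar>?F (W(i := y)) - ?F (W(i := y'))\<bar> = \<bar>expectation (\<lambda>z. F (W(i := y, j := z)) - F (W(i := y', j := z)))\<bar>"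
      using ints by simp
    also have "\<dots> \<le> expectation (\<lambda>z. \<bar>F (W(i := y, j := z)) - F (W(i := y', j := z))\<bar>)"
      by (rule integral_abs_bound)
    also have "\<dots> \<le> expectation (\<lambda>z. H y + H y')"
    proof (rule integral_mono)
      show "\<bar>F (W(i := y, j := z)) - F (W(i := y', j := z))\<bar> \<le> H y + H y'" if "z \<in> space M" for z
        using insert.prems(2)[OF sp[OF W that], of i y y'] i y by (simp only: fun_upd_twist[OF ij] insertI2)
    qed (use ints in auto)
    finally show ?thesis by (simp add: prob_space)
  qed
  have "(\<integral>\<^sup>+W. ennreal (exp (F W)) \<partial>PiM (insert j J) (\<lambda>_. M)) =
      (\<integral>\<^sup>+W. (\<integral>\<^sup>+y. ennreal (exp (F (W(j := y)))) \<partial>M) \<partial>PiM J (\<lambda>_. M))"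
    using insert.hyps by (intro prod.product_nn_integral_insert) auto
  also have "\<dots> \<le> (\<integral>\<^sup>+W. ennreal (exp c) * ennreal (exp (?F W)) \<partial>PiM J (\<lambda>_. M))"
    using one(2) by (intro nn_integral_mono) (simp add: exp_add ennreal_mult mult.commute)
  also have "\<dots> = ennreal (exp c) * (\<integral>\<^sup>+W. ennreal (exp (?F W)) \<partial>PiM J (\<lambda>_. M))"
    using F'i by (intro nn_integral_cmult) auto
  also have "\<dots> \<le> ennreal (exp c) * ennreal (exp ((\<integral>W. ?F W \<partial>PiM J (\<lambda>_. M)) + card J * c))"
    by (rule mult_left_mono[OF insert.IH[OF F'i F'd]]) simp_all
  also have "(\<integral>W. ?F W \<partial>PiM J (\<lambda>_. M)) = (\<integral>W. F W \<partial>PiM (insert j J) (\<lambda>_. M))"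
    using insert.hyps insert.prems(1) by (intro prod.product_integral_insert[symmetric]) auto
  finally show ?case
    using insert.hyps by (simp add: distrib_right add_ac flip: ennreal_mult exp_add)
qed

end

section \<open>Concentration of finite maxima\<close>

lemma abs_diff_Max_image_le:
  fixes f f' :: "'i \<Rightarrow> real"
  assumes I: "finite I" "I \<noteq> {}" and le: "\<And>i. i \<in> I \<Longrightarrow> \<bar>f i - f' i\<bar> \<le> e"
  shows "\<bar>Max (f ` I) - Max (f' ` I)\<bar> \<le> e"
proof -
  have *: "Max (f ` I) \<le> Max (f' ` I) + e" if le: "\<And>i. i \<in> I \<Longrightarrow> \<bar>f i - f' i\<bar> \<le> e" for f f' :: "'i \<Rightarrow> real"
  proof (rule Max.boundedI)
    fix x assume "x \<in> f ` I"
    then obtain i where i: "i \<in> I" "x = f i" by blast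
    then have "f' i \<le> Max (f' ` I)" using I by simp
    then show "x \<le> Max (f' ` I) + e" using le[OF i(1)] i by linarith
  qed (use I in auto)
  show ?thesis
  proof -
    have "Max (f ` I) \<le> Max (f' ` I) + e" "Max (f' ` I) \<le> Max (f ` I) + e"
      using le by (auto intro!: * simp: abs_minus_commute)
    then show ?thesis by linarith
  qed
qed

context prob_space
begin

text \<open>Chernoff bound for the maximum around its own mean: replacing one sample moves it by at
  most \<open>H y + H y'\<close>, so \<open>exp_moment_PiM\<close> applies with the one-coordinate
  bound of \<open>exp_moment_bernstein\<close>.\<close>

lemma Max_abs_sum_tail:
  fixes g :: "'i \<Rightarrow> 'a \<Rightarrow> real" and H :: "'a \<Rightarrow> real" and J :: "'j set" and K t :: real
  assumes I: "finite I" "I \<noteq> {}" and J: "finite J" "J \<noteq> {}"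
    and g[measurable]: "\<And>i. i \<in> I \<Longrightarrow> g i \<in> borel_measurable M"
    and H[measurable]: "H \<in> borel_measurable M"
    and gH: "\<And>i y. i \<in> I \<Longrightarrow> y \<in> space M \<Longrightarrow> \<bar>g i y\<bar> \<le> H y"
    and mom: "\<And>n::nat. n \<ge> 2 \<Longrightarrow> (\<integral>\<^sup>+y. ennreal (H y ^ n) \<partial>M) \<le> ennreal (fact n / 2 * K ^ (n - 2))"
    and K: "K \<ge> 1" and t: "t > 0"
  defines "Z \<equiv> \<lambda>W. Max ((\<lambda>i. \<bar>\<Sum>j\<in>J. g i (W j) - expectation (g i)\<bar>) ` I)"
    and "P \<equiv> PiM J (\<lambda>_. M)"
  shows "measure P {W \<in> space P. Z W \<ge> (\<integral>W. Z W \<partial>P) + 5 * sqrt (t * card J) + 2 * K * t} \<le> exp (- t)"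
proof -
  interpret P: prob_space P unfolding P_def by (intro prob_space_PiM) unfold_locales
  have H0: "0 \<le> H y" if "y \<in> space M" for y
    using I gH that by (meson abs_ge_zero all_not_in_conv order_trans)
  define m where "m = real (card J)"
  have m: "m > 0" using J by (simp add: m_def card_gt_0_iff)
  define s where "s = sqrt (t / m)"
  have s: "s > 0" "t = m * s\<^sup>2" using t m by (auto simp: s_def)
  define D where "D = 1 + 2 * K * s"
  have D: "D > 0" using K s by (auto simp: D_def intro!: add_pos_nonneg)
  \<comment> \<open>With \<open>s = \<surd>(t / m)\<close>, this choice makes the Chernoff exponent equal to \<open>t\<close> exactly; see \<open>key\<close>.\<close>
  define \<theta> where "\<theta> = s / D"
  have \<theta>: "\<theta> > 0" using s D by (simp add: \<theta>_def)
  have r: "1 - 2 * \<theta> * K = 1 / D"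
    using D by (simp add: \<theta>_def field_simps) (simp add: D_def)
  then have r1: "2 * \<theta> * K < 1" using D by (smt (verit) divide_pos_pos)
  define c where "c = 4 * \<theta>\<^sup>2 / (1 - 2 * \<theta> * K)"
  have step: "integrable M a \<and> (\<integral>\<^sup>+y. ennreal (exp (a y)) \<partial>M) \<le> ennreal (exp (expectation a + c))"
    if "a \<in> borel_measurable M"
      "\<And>y y'. y \<in> space M \<Longrightarrow> y' \<in> space M \<Longrightarrow> \<bar>a y - a y'\<bar> \<le> \<theta> * H y + \<theta> * H y'" for a
    using exp_moment_bernstein[OF H H0 mom K _ r1 that(1)] that(2) \<theta>
    by (simp add: c_def distrib_left)
  \<comment> \<open>Taking \<open>\<theta> * H\<close> itself as the function in \<open>step\<close>
    yields the integrability of \<open>H\<close>.\<close>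
  have "\<bar>\<theta> * H y - \<theta> * H y'\<bar> \<le> \<theta> * H y + \<theta> * H y'"
    if "y \<in> space M" "y' \<in> space M" for y y'
    using mult_nonneg_nonneg[OF less_imp_le[OF \<theta>] H0[OF that(1)]]
      mult_nonneg_nonneg[OF less_imp_le[OF \<theta>] H0[OF that(2)]] by linarith
  then have "integrable M (\<lambda>y. \<theta> * H y)"
    using step[of "\<lambda>y. \<theta> * H y"] by simp
  then have Hi: "integrable M H" using \<theta> by simp
  have gi: "integrable M (g i)" if "i \<in> I" for i
    using integrable_real_bound[OF Hi g[OF that] gH[OF that]] .
  have Zi: "integrable P Z"
    unfolding P_def Z_def using integrable_Max_abs_sum[OF I J(1) gi] by simp
  let ?EZ = "\<integral>W. Z W \<partial>P"
  let ?x = "5 * sqrt (t * m) + 2 * K * t"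
  have bd: "(\<integral>\<^sup>+W. ennreal (exp (\<theta> * Z W)) \<partial>P) \<le> ennreal (exp ((\<integral>W. \<theta> * Z W \<partial>P) + card J * c))"
    unfolding P_def
  proof (rule exp_moment_PiM[of "\<lambda>y. \<theta> * H y"])
    show "integrable (PiM J (\<lambda>_. M)) (\<lambda>W. \<theta> * Z W)" using Zi by (simp add: P_def)
    fix W j y y' assume j: "j \<in> J" and y: "y \<in> space M" "y' \<in> space M"
    \<comment> \<open>Only summand \<open>j\<close> sees the new sample, and the centring cancels in
      the difference.\<close>
    have upd: "(\<Sum>k\<in>J. g i ((W(j := y)) k) - expectation (g i)) =
        (g i y - expectation (g i)) + (\<Sum>k\<in>J - {j}. g i (W k) - expectation (g i))" for i y
      using J(1) j by (subst sum.remove[of _ j]) auto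
    have "\<bar>Z (W(j := y)) - Z (W(j := y'))\<bar> \<le> H y + H y'"
      unfolding Z_def
    proof (rule abs_diff_Max_image_le[OF I])
      fix i assume "i \<in> I"
      then show "\<bar>\<bar>\<Sum>k\<in>J. g i ((W(j := y)) k) - expectation (g i)\<bar> -
          \<bar>\<Sum>k\<in>J. g i ((W(j := y')) k) - expectation (g i)\<bar>\<bar> \<le> H y + H y'"
        unfolding upd using gH[OF _ y(1), of i] gH[OF _ y(2), of i] by linarith
    qed
    then have "\<theta> * \<bar>Z (W(j := y)) - Z (W(j := y'))\<bar> \<le> \<theta> * (H y + H y')"
      using \<theta> by (intro mult_left_mono) auto
    moreover have "\<bar>\<theta> * Z (W(j := y)) - \<theta> * Z (W(j := y'))\<bar> = \<theta> * \<bar>Z (W(j := y)) - Z (W(j := y'))\<bar>"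
      using \<theta> by (simp add: abs_mult flip: right_diff_distrib)
    ultimately show "\<bar>\<theta> * Z (W(j := y)) - \<theta> * Z (W(j := y'))\<bar> \<le> \<theta> * H y + \<theta> * H y'"
      by (simp add: distrib_left)
  qed (use step J in auto)
  have "sqrt (t * m) = m * s"
    using m s by (simp add: real_sqrt_mult power2_eq_square)
  then have "\<theta> * ?x - m * c = m * (\<theta> * (5 * s + 2 * K * s\<^sup>2) - 4 * \<theta>\<^sup>2 * D)"
    unfolding c_def r by (simp add: s(2) algebra_simps)
  \<comment> \<open>Since \<open>\<theta> * D = s\<close>, four of the five \<open>s\<close> pay for
    the exponential moment; what remains is \<open>s + 2 * K * s\<^sup>2 = s * D\<close>.\<close>
  also have "\<theta> * (5 * s + 2 * K * s\<^sup>2) - 4 * \<theta>\<^sup>2 * D = s\<^sup>2 * (D / D)"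
    unfolding \<theta>_def using D by (simp add: field_simps power2_eq_square) (simp add: D_def algebra_simps)
  finally have key: "\<theta> * ?x - m * c = t" using D s by simp
  let ?A = "{W \<in> space P. Z W \<ge> ?EZ + ?x}"
  have [measurable]: "Z \<in> borel_measurable P" using Zi by auto
  have "emeasure P ?A = (\<integral>\<^sup>+W. indicator ?A W \<partial>P)" by simp
  also have "\<dots> \<le> (\<integral>\<^sup>+W. ennreal (exp (- (\<theta> * (?EZ + ?x)))) * ennreal (exp (\<theta> * Z W)) \<partial>P)"
  proof (intro nn_integral_mono)
    fix W
    have "\<theta> * (?EZ + ?x) \<le> \<theta> * Z W" if "W \<in> ?A"
      using that \<theta> by (intro mult_left_mono) auto
    then show "indicator ?A W \<le> ennreal (exp (- (\<theta> * (?EZ + ?x)))) * ennreal (exp (\<theta> * Z W))"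
      by (auto simp: indicator_def simp flip: ennreal_mult exp_add)
  qed
  also have "\<dots> = ennreal (exp (- (\<theta> * (?EZ + ?x)))) * (\<integral>\<^sup>+W. ennreal (exp (\<theta> * Z W)) \<partial>P)"
    by (intro nn_integral_cmult) simp
  also have "\<dots> \<le> ennreal (exp (- (\<theta> * (?EZ + ?x)))) * ennreal (exp ((\<integral>W. \<theta> * Z W \<partial>P) + m * c))"
    using bd unfolding m_def by (intro mult_left_mono) auto
  also have "\<dots> = ennreal (exp (- (\<theta> * ?x - m * c)))"
    by (simp add: algebra_simps flip: ennreal_mult exp_add)
  finally have "emeasure P ?A \<le> ennreal (exp (- t))" unfolding key .
  then show ?thesis
    by (simp add: P.emeasure_eq_measure m_def add.assoc)
qed

section \<open>Chaining\<close>

text \<open>One link of the chain: each value on \<open>U\<close> is the value at a nearby point of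
  \<open>T\<close> plus an increment with envelope \<open>r * B\<close>, whose L2 norm is at most
  \<open>C * r\<close>. A separate \<open>e\<close> keeps the scale positive when
  \<open>C = 0\<close>.\<close>

lemma expectation_Max_abs_chain_step:
  fixes h :: "'b::euclidean_space \<Rightarrow> 'a \<Rightarrow> real" and J :: "'j set" and C e r :: real
  assumes J: "finite J" "J \<noteq> {}"
    and hi: "\<And>z. integrable M (h z)"
    and B[measurable]: "B \<in> borel_measurable M" and B0: "\<And>y. y \<in> space M \<Longrightarrow> 0 \<le> B y"
    and lip: "\<And>z z' y. y \<in> space M \<Longrightarrow> \<bar>h z y - h z' y\<bar> \<le> dist z z' * B y"
    and B2: "integrable M (\<lambda>y. (B y)\<^sup>2)" "expectation (\<lambda>y. (B y)\<^sup>2) \<le> C\<^sup>2" "C \<ge> 0"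
    and U: "finite U" "U \<noteq> {}" and T: "finite T" "T \<noteq> {}"
    and cov: "\<And>u. u \<in> U \<Longrightarrow> \<exists>v\<in>T. dist u v \<le> r" and r: "r > 0" "C * r \<le> e" "e > 0"
  defines "Z \<equiv> \<lambda>A W. Max ((\<lambda>z. \<bar>\<Sum>j\<in>J. h z (W j) - expectation (h z)\<bar>) ` A)"
  shows "(\<integral>W. Z U W \<partial>PiM J (\<lambda>_. M)) \<le>
    (\<integral>W. Z T W \<partial>PiM J (\<lambda>_. M)) + 2 * e * sqrt (2 * card J * ln (2 * card U))"
proof -
  obtain \<pi> where \<pi>: "\<And>u. u \<in> U \<Longrightarrow> \<pi> u \<in> T" "\<And>u. u \<in> U \<Longrightarrow> dist u (\<pi> u) \<le> r"
    using cov by metis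
  define g where "g u y = h u y - h (\<pi> u) y" for u y
  have gi: "integrable M (g u)" for u unfolding g_def using hi by auto
  have Eg: "expectation (g u) = expectation (h u) - expectation (h (\<pi> u))" for u
    unfolding g_def using hi by simp
  let ?Y = "\<lambda>W. Max ((\<lambda>u. \<bar>\<Sum>j\<in>J. g u (W j) - expectation (g u)\<bar>) ` U)"
  have "(\<integral>W. Z U W \<partial>PiM J (\<lambda>_. M)) \<le> (\<integral>W. Z T W + ?Y W \<partial>PiM J (\<lambda>_. M))"
  proof (rule integral_mono)
    show "integrable (PiM J (\<lambda>_. M)) (Z U)" "integrable (PiM J (\<lambda>_. M)) (\<lambda>W. Z T W + ?Y W)"
      unfolding Z_def using U T J hi gi by (auto intro!: integrable_Max_abs_sum)
    fix W
    show "Z U W \<le> Z T W + ?Y W"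
      unfolding Z_def
    proof (rule Max.boundedI)
      fix x assume "x \<in> (\<lambda>z. \<bar>\<Sum>j\<in>J. h z (W j) - expectation (h z)\<bar>) ` U"
      then obtain u where u: "u \<in> U" "x = \<bar>\<Sum>j\<in>J. h u (W j) - expectation (h u)\<bar>" by blast
      have 1: "\<bar>\<Sum>j\<in>J. h (\<pi> u) (W j) - expectation (h (\<pi> u))\<bar> \<le>
          Max ((\<lambda>z. \<bar>\<Sum>j\<in>J. h z (W j) - expectation (h z)\<bar>) ` T)"
        using T \<pi>(1)[OF u(1)] by (intro Max_ge) auto
      have 2: "\<bar>\<Sum>j\<in>J. g u (W j) - expectation (g u)\<bar> \<le> ?Y W"
        using U u by (intro Max_ge) auto
      have "(\<Sum>j\<in>J. h u (W j) - expectation (h u)) =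
          (\<Sum>j\<in>J. h (\<pi> u) (W j) - expectation (h (\<pi> u))) + (\<Sum>j\<in>J. g u (W j) - expectation (g u))"
        unfolding sum.distrib[symmetric] Eg by (simp add: g_def)
      with 1 2 u(2) show "x \<le> Max ((\<lambda>z. \<bar>\<Sum>j\<in>J. h z (W j) - expectation (h z)\<bar>) ` T) + ?Y W"
        by linarith
    qed (use U in auto)
  qed
  also have "\<dots> = (\<integral>W. Z T W \<partial>PiM J (\<lambda>_. M)) + (\<integral>W. ?Y W \<partial>PiM J (\<lambda>_. M))"
    unfolding Z_def using U T J hi gi by (intro Bochner_Integration.integral_add integrable_Max_abs_sum) auto
  also have "(\<integral>W. ?Y W \<partial>PiM J (\<lambda>_. M)) \<le> 2 * e * sqrt (2 * card J * ln (2 * card U))"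
  proof (rule expectation_Max_abs_sum_le[OF U J, where G = "\<lambda>y. r * B y"])
    show "\<bar>g u y\<bar> \<le> r * B y" if "u \<in> U" "y \<in> space M" for u y
      using lip[OF that(2), of u "\<pi> u"] mult_right_mono[OF \<pi>(2)[OF that(1)] B0[OF that(2)]]
      by (simp add: g_def)
    have "expectation (\<lambda>y. (r * B y)\<^sup>2) = r\<^sup>2 * expectation (\<lambda>y. (B y)\<^sup>2)"
      by (simp add: power_mult_distrib)
    also have "\<dots> \<le> r\<^sup>2 * C\<^sup>2" using B2 by (intro mult_left_mono) auto
    also have "\<dots> = (C * r)\<^sup>2" by (simp add: power_mult_distrib)
    also have "\<dots> \<le> e\<^sup>2" using r B2 by (intro power_mono) auto
    finally show "expectation (\<lambda>y. (r * B y)\<^sup>2) \<le> e\<^sup>2" .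
    show "integrable M (\<lambda>y. (r * B y)\<^sup>2)" using B2 by (simp add: power_mult_distrib)
  qed (use r gi in auto)
  finally show ?thesis by simp
qed

text \<open>Dyadic nets of the ball: the log-cardinality at scale \<open>s\<close> grows only
  linearly in \<open>s\<close> while the increments halve, so the costs sum to
  \<open>10 * Q\<close>. The last summand \<open>sqrt (card J)\<close> pays for passing from a fine
  net to \<open>U\<close>; the bound does not depend on the size of \<open>U\<close>.\<close>

lemma expectation_Max_abs_chaining:
  fixes h :: "'b::euclidean_space \<Rightarrow> 'a \<Rightarrow> real" and J :: "'j set" and C R :: real
  assumes J: "finite J" "J \<noteq> {}"
    and h[measurable]: "\<And>z. h z \<in> borel_measurable M"
    and H[measurable]: "H \<in> borel_measurable M"
    and hH: "\<And>z y. y \<in> space M \<Longrightarrow> \<bar>h z y\<bar> \<le> H y"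
    and H2: "integrable M (\<lambda>y. (H y)\<^sup>2)" "expectation (\<lambda>y. (H y)\<^sup>2) \<le> 1"
    and B: "B \<in> borel_measurable M" and B0: "\<And>y. y \<in> space M \<Longrightarrow> 0 \<le> B y"
    and lip: "\<And>z z' y. y \<in> space M \<Longrightarrow> \<bar>h z y - h z' y\<bar> \<le> dist z z' * B y"
    and B2: "integrable M (\<lambda>y. (B y)\<^sup>2)" "expectation (\<lambda>y. (B y)\<^sup>2) \<le> C\<^sup>2" "C \<ge> 0"
    and R: "R \<ge> 0" and U: "finite U" "U \<noteq> {}" "U \<subseteq> cball 0 R"
  defines "Z \<equiv> \<lambda>A W. Max ((\<lambda>z. \<bar>\<Sum>j\<in>J. h z (W j) - expectation (h z)\<bar>) ` A)"
  shows "(\<integral>W. Z U W \<partial>PiM J (\<lambda>_. M)) \<le>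
    10 * sqrt (2 * card J * (DIM('b) * ln (16 * R * C + 4))) + sqrt (card J)"
proof -
  have Hi: "integrable M H" using square_integrable_imp_integrable[OF H H2(1)] .
  have hi: "integrable M (h z)" for z
    using integrable_real_bound[OF Hi h hH] .
  define m where "m = real (card J)"
  have m: "m > 0" using J by (simp add: m_def card_gt_0_iff)
  define Lg where "Lg = ln (16 * R * C + 4)"
  have RC: "R * C \<ge> 0" using R B2 by simp
  have "ln 4 \<le> Lg" unfolding Lg_def using R B2(3) by (intro ln_mono) auto
  moreover have "ln (4 :: real) = 2 * ln 2" using ln_realpow[of "2::real" 2] by simp
  ultimately have Lg: "2 * ln 2 \<le> Lg" by simp
  have Lg0: "Lg > 0" by (rule less_le_trans[OF _ Lg]) simp
  \<comment> \<open>\<open>\<eta>\<close> keeps the scale finite when \<open>C = 0\<close>.\<close>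
  define \<eta> where "\<eta> = 1 / (8 * (R + 1))"
  have \<eta>: "\<eta> > 0" "R * \<eta> \<le> 1 / 8" using R by (auto simp: \<eta>_def field_simps)
  define r where "r s = 1 / (2 ^ s * (C + \<eta>))" for s :: nat
  have r: "r s > 0" "C * r s \<le> 1 / 2 ^ s" for s
  proof -
    have pos: "C + \<eta> > 0" using B2(3) \<eta>(1) by simp
    then show "r s > 0" by (simp add: r_def)
    have "C * r s = C / (C + \<eta>) * (1 / 2 ^ s)" by (simp add: r_def)
    also have "\<dots> \<le> 1 * (1 / 2 ^ s)" using pos \<eta>(1) by (intro mult_right_mono) auto
    finally show "C * r s \<le> 1 / 2 ^ s" by simp
  qed
  have "\<exists>T :: 'b set. finite T \<and> T \<noteq> {} \<and> T \<subseteq> cball 0 R \<and>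
    (\<forall>z\<in>cball 0 R. \<exists>u\<in>T. dist z u \<le> r s) \<and> real (card T) \<le> (1 + 2 * R / r s) ^ DIM('b)" for s
    using ball_net[OF r(1)[of s] R] by metis
  then obtain T where T: "\<And>s. finite (T s)" "\<And>s. T s \<noteq> {}" "\<And>s. T s \<subseteq> cball (0::'b) R"
    "\<And>s z. z \<in> cball 0 R \<Longrightarrow> \<exists>u\<in>T s. dist z u \<le> r s"
    "\<And>s. real (card (T s)) \<le> (1 + 2 * R / r s) ^ DIM('b)"
    by metis
  \<comment> \<open>The factor 2 is at most \<open>2 ^ DIM('b)\<close> and joins the power;
    \<open>R * \<eta> \<le> 1 / 8\<close> leads to \<open>16 * R * C + 4\<close>. As
    \<open>Lg \<ge> ln 4\<close>, the term \<open>s * ln 2\<close> is at most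
    \<open>Lg * s / 2\<close>.\<close>
  have lnT: "ln (2 * card (T s)) \<le> DIM('b) * Lg * (1 + s / 2)" for s
  proof -
    have "1 + 2 * R / r s = 1 + 2 ^ s * (2 * (R * C + R * \<eta>))"
      by (simp add: r_def algebra_simps)
    also have "\<dots> \<le> 2 ^ s * 1 + 2 ^ s * (2 * (R * C + 1 / 8))"
      using \<eta>(2) by (intro add_mono mult_left_mono[of _ _ "2 ^ s"]) auto
    also have "\<dots> = 2 ^ s * (5 / 4 + 2 * (R * C))" by (simp add: algebra_simps)
    also have "\<dots> \<le> 2 ^ s * ((16 * R * C + 4) / 2)"
    proof (rule mult_left_mono)
      show "5 / 4 + 2 * (R * C) \<le> (16 * R * C + 4) / 2" using RC by argo
    qed simp
    finally have le: "1 + 2 * R / r s \<le> 2 ^ s * ((16 * R * C + 4) / 2)" .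
    have c: "card (T s) > 0" using T by (simp add: card_gt_0_iff)
    have "2 * real (card (T s)) \<le> 2 ^ DIM('b) * (1 + 2 * R / r s) ^ DIM('b)"
    proof (rule mult_mono)
      show "(2::real) \<le> 2 ^ DIM('b)" using power_increasing[of 1 "DIM('b)" "2::real"] by simp
    qed (use T in auto)
    also have "\<dots> = (2 * (1 + 2 * R / r s)) ^ DIM('b)" by (simp only: power_mult_distrib)
    also have "\<dots> \<le> (2 ^ s * (16 * R * C + 4)) ^ DIM('b)"
    proof (rule power_mono)
      show "2 * (1 + 2 * R / r s) \<le> 2 ^ s * (16 * R * C + 4)" using le by simp
      show "0 \<le> 2 * (1 + 2 * R / r s)" using R r(1)[of s] by (simp add: add_nonneg_nonneg)
    qed
    finally have "ln (2 * card (T s)) \<le> ln ((2 ^ s * (16 * R * C + 4)) ^ DIM('b))"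
      using c by (intro ln_mono) auto
    also have "\<dots> = DIM('b) * (s * ln 2 + Lg)"
    proof -
      have "16 * R * C + 4 > 0" using RC by argo
      then show ?thesis unfolding Lg_def by (simp add: ln_realpow ln_mult_pos)
    qed
    also have "\<dots> \<le> DIM('b) * (Lg * (1 + s / 2))"
      using mult_left_mono[OF Lg, of "real s / 2"] by (intro mult_left_mono) (auto simp: algebra_simps)
    finally show ?thesis by (simp add: mult.assoc)
  qed
  define Q where "Q = sqrt (2 * m * (DIM('b) * Lg))"
  \<comment> \<open>Replacing \<open>sqrt (1 + s / 2)\<close> by \<open>1 + s / 2\<close> gives the
    sum over scales a closed form.\<close>
  have sqT: "sqrt (2 * m * ln (2 * card (T s))) \<le> Q * (1 + s / 2)" for s
  proof -
    have "2 * m * ln (2 * card (T s)) \<le> 2 * m * (DIM('b) * Lg * (1 + s / 2))"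
      using lnT m by (intro mult_left_mono) auto
    then have "sqrt (2 * m * ln (2 * card (T s))) \<le> sqrt (2 * m * (DIM('b) * Lg) * (1 + s / 2))"
      by (intro real_sqrt_le_mono) (simp add: mult.assoc)
    also have "\<dots> = Q * sqrt (1 + s / 2)" by (simp only: Q_def real_sqrt_mult)
    also have "\<dots> \<le> Q * (1 + s / 2)"
    proof (intro mult_left_mono)
      have "1 + real s / 2 \<le> (1 + real s / 2)\<^sup>2" by (simp add: power2_eq_square algebra_simps)
      then show "sqrt (1 + real s / 2) \<le> 1 + real s / 2" by (intro real_le_lsqrt) auto
      show "0 \<le> Q" using m Lg0 by (simp add: Q_def)
    qed
    finally show ?thesis .
  qed
  have Q0: "Q \<ge> 0" using m Lg0 by (simp add: Q_def)
  let ?E = "\<lambda>A. \<integral>W. Z A W \<partial>PiM J (\<lambda>_. M)"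
  \<comment> \<open>The bracket equals 1 plus the sum over \<open>k < n\<close> of
    \<open>(1 + (k + 1) / 2) / 2 ^ k\<close>. The initial 1 comes from the coarsest net, where the
    values themselves are bounded through the envelope \<open>H\<close>.\<close>
  have chain: "?E (T n) \<le> 2 * Q * (5 - (real n + 4) / 2 ^ n)" for n
  proof (induction n)
    case 0
    have "?E (T 0) \<le> 2 * 1 * sqrt (2 * card J * ln (2 * card (T 0)))"
      unfolding Z_def using H2 hH by (intro expectation_Max_abs_sum_le T J h H) auto
    also have "\<dots> \<le> 2 * Q" using sqT[of 0] by (simp add: m_def)
    finally show ?case by simp
  next
    case (Suc n)
    have cov: "\<exists>v\<in>T n. dist u v \<le> r n" if "u \<in> T (Suc n)" for u
      using T(3)[of "Suc n"] T(4) that by blast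
    have "?E (T (Suc n)) \<le> ?E (T n) + 2 * (1 / 2 ^ n) * sqrt (2 * card J * ln (2 * card (T (Suc n))))"
      unfolding Z_def
      by (rule expectation_Max_abs_chain_step[OF J hi B B0 lip B2 T(1,2) T(1,2) cov r]) auto
    also have "\<dots> \<le> 2 * Q * (5 - (real n + 4) / 2 ^ n) + 2 * (1 / 2 ^ n) * (Q * (1 + Suc n / 2))"
      using Suc.IH sqT[of "Suc n"] unfolding m_def by (intro add_mono mult_left_mono) auto
    also have "\<dots> = 2 * Q * (5 - (real (Suc n) + 4) / 2 ^ Suc n)"
      by (simp add: field_simps)
    finally show ?case .
  qed
  \<comment> \<open>The net is made so fine, depending on \<open>U\<close>, that the final link
    costs at most \<open>sqrt m\<close>.\<close>
  obtain n where n: "2 * sqrt (2 * ln (2 * card U)) < 2 ^ n"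
    using real_arch_pow[of 2] by auto
  have cov: "\<exists>v\<in>T n. dist u v \<le> r n" if "u \<in> U" for u
    using U(3) T(4) that by blast
  have "?E U \<le> ?E (T n) + 2 * (1 / 2 ^ n) * sqrt (2 * card J * ln (2 * card U))"
    unfolding Z_def
    by (rule expectation_Max_abs_chain_step[OF J hi B B0 lip B2 U(1,2) T(1,2) cov r]) auto
  also have "sqrt (2 * card J * ln (2 * card U)) = sqrt m * sqrt (2 * ln (2 * card U))"
    by (simp add: m_def flip: real_sqrt_mult)
  also have "2 * (1 / 2 ^ n) * (sqrt m * sqrt (2 * ln (2 * card U))) =
      sqrt m * (2 * sqrt (2 * ln (2 * card U)) / 2 ^ n)" by simp
  also have "\<dots> \<le> sqrt m * 1"
    using n m by (intro mult_left_mono) auto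
  also have "?E (T n) \<le> 2 * Q * 5"
    using chain[of n] mult_left_mono[of "5 - (real n + 4) / 2 ^ n" 5 "2 * Q"] Q0 by auto
  finally show ?thesis by (simp add: Q_def Lg_def m_def)
qed

section \<open>From finite sets to the whole ball\<close>

text \<open>The bound for finite sets is uniform, so it survives an increasing exhaustion of a
  countable dense subset of the ball. For fixed samples the sum is Lipschitz in \<open>z\<close>,
  and a strict excess over \<open>a\<close> persists at a nearby dense point. The countable union is
  the measurable enclosing set.\<close>

lemma sup_abs_sum_tail:
  fixes h :: "'b::euclidean_space \<Rightarrow> 'a \<Rightarrow> real" and J :: "'j set" and C K R t :: real
  assumes J: "finite J" "J \<noteq> {}"
    and h[measurable]: "\<And>z. h z \<in> borel_measurable M"
    and H[measurable]: "H \<in> borel_measurable M"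
    and hH: "\<And>z y. y \<in> space M \<Longrightarrow> \<bar>h z y\<bar> \<le> H y"
    and mom: "\<And>n::nat. n \<ge> 2 \<Longrightarrow> (\<integral>\<^sup>+y. ennreal (H y ^ n) \<partial>M) \<le> ennreal (fact n / 2 * K ^ (n - 2))"
    and B: "B \<in> borel_measurable M" and B0: "\<And>y. y \<in> space M \<Longrightarrow> 0 \<le> B y"
    and lip: "\<And>z z' y. y \<in> space M \<Longrightarrow> \<bar>h z y - h z' y\<bar> \<le> dist z z' * B y"
    and B2: "integrable M (\<lambda>y. (B y)\<^sup>2)" "expectation (\<lambda>y. (B y)\<^sup>2) \<le> C\<^sup>2" "C \<ge> 0"
    and K: "K \<ge> 1" and t: "t > 0" and R: "R \<ge> 0"
  defines "P \<equiv> PiM J (\<lambda>_. M)"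
    and "a \<equiv> 10 * sqrt (2 * card J * (DIM('b) * ln (16 * R * C + 4))) + sqrt (card J)
      + 5 * sqrt (t * card J) + 2 * K * t"
  shows "\<exists>A\<in>sets P. {W \<in> space P. \<exists>z\<in>cball 0 R. a < \<bar>\<Sum>j\<in>J. h z (W j) - expectation (h z)\<bar>} \<subseteq> A
    \<and> measure P A \<le> exp (- t)"
proof -
  interpret P: prob_space P unfolding P_def by (intro prob_space_PiM) unfold_locales
  have H2: "integrable M (\<lambda>y. (H y)\<^sup>2)" "expectation (\<lambda>y. (H y)\<^sup>2) \<le> 1"
    using second_moment_le_one[OF H mom[of 2]] by auto
  have Hi: "integrable M H" using square_integrable_imp_integrable[OF H H2(1)] .
  have Bi: "integrable M B" using square_integrable_imp_integrable[OF B B2(1)] .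
  have hi: "integrable M (h z)" for z
    using integrable_real_bound[OF Hi h hH] .
  define X where "X z W = (\<Sum>j\<in>J. h z (W j) - expectation (h z))" for z W
  have Xm[measurable]: "X z \<in> borel_measurable P" for z
    unfolding X_def P_def
    using borel_measurable_integrable[OF integrable_PiM_component[OF _ hi, of _ J]] by auto
  obtain D where D: "countable D" "D \<subseteq> cball (0::'b) R" "cball 0 R \<subseteq> closure D"
    using separable[of "cball (0::'b) R"] by blast
  have "D \<noteq> {}" using D(3) R by auto
  define u where "u = from_nat_into D"
  have uD: "range u = D" unfolding u_def by (rule range_from_nat_into[OF \<open>D \<noteq> {}\<close> D(1)])
  let ?A = "\<lambda>n. {W \<in> space P. \<exists>i\<le>n. a < \<bar>X (u i) W\<bar>}"
  have Am: "?A n \<in> sets P" for n by measurable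
  have "measure P (?A n) \<le> exp (- t)" for n
  proof -
    let ?U = "u ` {..n}"
    let ?Z = "\<lambda>W. Max ((\<lambda>z. \<bar>\<Sum>j\<in>J. h z (W j) - expectation (h z)\<bar>) ` ?U)"
    have U: "finite ?U" "?U \<noteq> {}" "?U \<subseteq> cball 0 R" using uD D(2) by auto
    have E: "(\<integral>W. ?Z W \<partial>P) \<le> 10 * sqrt (2 * card J * (DIM('b) * ln (16 * R * C + 4))) + sqrt (card J)"
      unfolding P_def by (rule expectation_Max_abs_chaining[OF J h H hH H2 B B0 lip B2 R U])
    have "?A n \<subseteq> {W \<in> space P. ?Z W \<ge> (\<integral>W. ?Z W \<partial>P) + 5 * sqrt (t * card J) + 2 * K * t}"
    proof safe
      fix W i assume i: "i \<le> n" "a < \<bar>X (u i) W\<bar>"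
      have "\<bar>X (u i) W\<bar> \<le> ?Z W"
        unfolding X_def using i by (intro Max_ge) auto
      with i E show "(\<integral>W. ?Z W \<partial>P) + 5 * sqrt (t * card J) + 2 * K * t \<le> ?Z W"
        unfolding a_def by linarith
    qed
    then have "measure P (?A n) \<le> measure P {W \<in> space P. ?Z W \<ge> (\<integral>W. ?Z W \<partial>P) + 5 * sqrt (t * card J) + 2 * K * t}"
    proof (rule P.finite_measure_mono)
      have "?Z \<in> borel_measurable P"
        using integrable_Max_abs_sum[OF U(1,2) J(1) hi] unfolding P_def by auto
      then show "{W \<in> space P. ?Z W \<ge> (\<integral>W. ?Z W \<partial>P) + 5 * sqrt (t * card J) + 2 * K * t} \<in> sets P"
        by measurable
    qed
    also have "\<dots> \<le> exp (- t)"
      unfolding P_def by (rule Max_abs_sum_tail[OF U(1,2) J h H hH mom K t])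
    finally show ?thesis .
  qed
  moreover have "(\<lambda>n. measure P (?A n)) \<longlonglongrightarrow> measure P (\<Union>n. ?A n)"
    using Am by (intro P.finite_Lim_measure_incseq) (auto intro!: incseq_SucI intro: le_SucI)
  ultimately have "measure P (\<Union>n. ?A n) \<le> exp (- t)"
    by (intro LIMSEQ_le_const2) auto
  moreover have "{W \<in> space P. \<exists>z\<in>cball 0 R. a < \<bar>X z W\<bar>} \<subseteq> (\<Union>n. ?A n)"
  proof safe
    fix W z assume W: "W \<in> space P" and z: "z \<in> cball 0 R" "a < \<bar>X z W\<bar>"
    have Wj: "W j \<in> space M" if "j \<in> J" for j
      using W that by (auto simp: P_def space_PiM)
    have XL: "\<bar>X z W - X z' W\<bar> \<le> (\<Sum>j\<in>J. B (W j) + expectation B) * dist z z'" for z z'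
    proof -
      have "\<bar>expectation (h z) - expectation (h z')\<bar> = \<bar>expectation (\<lambda>y. h z y - h z' y)\<bar>"
        using hi by simp
      also have "\<dots> \<le> expectation (\<lambda>y. \<bar>h z y - h z' y\<bar>)" by (rule integral_abs_bound)
      also have "\<dots> \<le> expectation (\<lambda>y. dist z z' * B y)"
        using hi Bi lip by (intro integral_mono) auto
      finally have 1: "\<bar>expectation (h z) - expectation (h z')\<bar> \<le> dist z z' * expectation B" by simp
      have "\<bar>X z W - X z' W\<bar> = \<bar>\<Sum>j\<in>J. (h z (W j) - h z' (W j)) - (expectation (h z) - expectation (h z'))\<bar>"
        unfolding X_def sum_subtractf[symmetric] by (simp add: algebra_simps)
      also have "\<dots> \<le> (\<Sum>j\<in>J. \<bar>(h z (W j) - h z' (W j)) - (expectation (h z) - expectation (h z'))\<bar>)"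
        by (rule sum_abs)
      also have "\<dots> \<le> (\<Sum>j\<in>J. (B (W j) + expectation B) * dist z z')"
      proof (rule sum_mono)
        fix j assume "j \<in> J"
        then show "\<bar>(h z (W j) - h z' (W j)) - (expectation (h z) - expectation (h z'))\<bar> \<le>
            (B (W j) + expectation B) * dist z z'"
          using lip[OF Wj, of j z z'] 1 by (simp add: algebra_simps)
      qed
      finally show ?thesis by (simp add: sum_distrib_right)
    qed
    \<comment> \<open>The added 1 makes the Lipschitz constant positive, for the division
      below.\<close>
    define b where "b = (\<Sum>j\<in>J. B (W j) + expectation B) + 1"
    have "0 \<le> expectation B" using B0 by (intro integral_nonneg_AE AE_I2)
    then have b: "b > 0" unfolding b_def using B0 Wj by (intro add_nonneg_pos sum_nonneg) auto
    have "z \<in> closure D" using z D(3) by blast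
    moreover have "(\<bar>X z W\<bar> - a) / b > 0" using z b by simp
    ultimately obtain z' where z': "z' \<in> D" "dist z' z < (\<bar>X z W\<bar> - a) / b"
      unfolding closure_approachable by blast
    have "\<bar>X z W - X z' W\<bar> \<le> b * dist z z'"
      by (rule order_trans[OF XL]) (auto simp: b_def intro: mult_right_mono)
    also have "\<dots> < \<bar>X z W\<bar> - a"
      using z'(2) b by (simp add: field_simps dist_commute)
    finally have "a < \<bar>X z' W\<bar>" by linarith
    moreover obtain i where "z' = u i" using z' uD by blast
    ultimately show "W \<in> (\<Union>n. ?A n)" using W by blast
  qed
  moreover have "(\<Union>n. ?A n) \<in> sets P" using Am by (intro sets.countable_UN) auto
  ultimately show ?thesis
    unfolding X_def by blast
qed

end

section \<open>The approximation error\<close>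

lemma abs_cos_diff_le: "\<bar>cos u - cos v\<bar> \<le> \<bar>u - v\<bar>" for u v :: real
proof -
  have "\<bar>cos u - cos v\<bar> = 2 * (\<bar>sin ((u + v) / 2)\<bar> * \<bar>sin ((v - u) / 2)\<bar>)"
    unfolding cos_diff_cos by (simp add: abs_mult)
  also have "\<dots> \<le> 2 * (1 * \<bar>(v - u) / 2\<bar>)"
    by (intro mult_left_mono mult_mono abs_sin_le_one abs_sin_x_le_abs_x) auto
  finally show ?thesis by simp
qed

text \<open>Comparison term by term, with \<open>10 * sqrt 2 \<le> 7 * sqrt 6\<close> and
  \<open>24 * 6 / 4 = 36 \<ge> 2\<close>. Strictness comes from the terms in
  \<open>1 / sqrt m\<close>; it is what turns a supremum reaching the bound into a strict excess at
  one point.\<close>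

lemma deviation_less_bound:
  fixes m d Lg K t :: real
  assumes "m > 0" "d \<ge> 0" "Lg \<ge> 0" "K \<ge> 1" "t > 0"
  shows "(10 * sqrt (2 * m * (d * Lg)) + sqrt m + 5 * sqrt (t * m) + 2 * K * t) / m
    < 7 * sqrt 6 * (1 + sqrt pi / (ln 2) powr (3/2)) * sqrt (d * Lg) / sqrt m
      + (14 * sqrt (6 * ln 2) + 1) / sqrt m + 36 * K * (ln 2 + 1) / m
      + 24 * sqrt 6 / sqrt m * (sqrt t + sqrt 6 * K / (2 * sqrt m) * t / 2)"
proof -
  have "sqrt 6 \<ge> 1" by simp
  then have s6: "5 \<le> 24 * sqrt 6" by linarith
  have "10 * sqrt 2 \<le> 7 * sqrt 6"
    by (rule power2_le_imp_le) (auto simp: power_mult_distrib)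
  also have "\<dots> \<le> 7 * sqrt 6 * (1 + sqrt pi / (ln 2) powr (3/2))"
    by (simp add: algebra_simps)
  finally have c3: "10 * sqrt 2 * (sqrt (d * Lg) / sqrt m) \<le>
      7 * sqrt 6 * (1 + sqrt pi / (ln 2) powr (3/2)) * (sqrt (d * Lg) / sqrt m)"
    using assms by (intro mult_right_mono) auto
  have mm: "sqrt m / m = 1 / sqrt m" using assms real_div_sqrt[of m] by (simp add: field_simps)
  have mm': "x * sqrt m / m = x / sqrt m" for x
    using arg_cong[OF mm, of "\<lambda>y. x * y"] by simp
  have "10 * sqrt (2 * m * (d * Lg)) / m = (10 * sqrt 2 * sqrt (d * Lg)) * sqrt m / m"
    by (simp add: real_sqrt_mult mult_ac)
  then have 1: "10 * sqrt (2 * m * (d * Lg)) / m = 10 * sqrt 2 * (sqrt (d * Lg) / sqrt m)"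
    unfolding mm' by simp
  have 2: "5 * sqrt (t * m) / m \<le> 24 * sqrt 6 / sqrt m * sqrt t"
  proof -
    have "5 * sqrt (t * m) / m = 5 * (sqrt t / sqrt m)"
      using mm'[of "5 * sqrt t"] by (simp add: real_sqrt_mult)
    also have "\<dots> \<le> (24 * sqrt 6) * (sqrt t / sqrt m)" using s6 assms by (intro mult_right_mono) auto
    finally show ?thesis by simp
  qed
  have 3: "2 * K * t / m \<le> 24 * sqrt 6 / sqrt m * (sqrt 6 * K / (2 * sqrt m) * t / 2)"
  proof -
    have "24 * sqrt 6 / sqrt m * (sqrt 6 * K / (2 * sqrt m) * t / 2) =
        24 * (sqrt 6 * sqrt 6) * K * t / (4 * (sqrt m * sqrt m))" by simp
    also have "\<dots> = 36 * (K * t / m)" using assms by simp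
    finally have "24 * sqrt 6 / sqrt m * (sqrt 6 * K / (2 * sqrt m) * t / 2) = 36 * (K * t / m)" .
    moreover have "0 \<le> K * t / m" using assms by simp
    moreover have "2 * K * t / m = 2 * (K * t / m)" by simp
    ultimately show ?thesis by linarith
  qed
  have 4: "sqrt m / m < (14 * sqrt (6 * ln 2) + 1) / sqrt m"
    unfolding mm using assms by (intro divide_strict_right_mono) auto
  have 5: "0 \<le> 36 * K * (ln 2 + 1) / m" using assms by simp
  show ?thesis
    using c3 1 2 3 4 5 by (simp only: add_divide_distrib distrib_left times_divide_eq_right)
qed

text \<open>The event is enclosed in a measurable set, which bounds its outer probability. The
  supremum in \<open>ereal\<close> is minus infinity for empty \<open>S\<close>, so that case needs
  no separate treatment.\<close>

theorem theorem1:
  fixes \<Lambda> :: "(real^'n) measure"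
    and k :: "real^'n \<Rightarrow> real^'n \<Rightarrow> real"
    and p q :: "'n \<Rightarrow> nat"
    and K t :: real and m :: nat and S :: "(real^'n) set"
  assumes prob: "prob_space \<Lambda>" and borel: "sets \<Lambda> = sets borel"
    and kernel: "\<And>x y. k x y = (\<integral>\<omega>. cos (\<omega> \<bullet> (x - y)) \<partial>\<Lambda>)"
    and kcont: "continuous_on UNIV (\<lambda>(x, y). k x y)"
    and kbdd: "bounded (range (\<lambda>(x, y). k x y))"
    and deriv_ex: "mpartial2_exists p q k"
    and sigma_int: "integrable \<Lambda> (\<lambda>\<omega>. \<bar>mono (\<lambda>j. p j + q j) \<omega>\<bar>\<^sup>2)"
    and sigma_pos: "sqrt (\<integral>\<omega>. \<bar>mono (\<lambda>j. p j + q j) \<omega>\<bar>\<^sup>2 \<partial>\<Lambda>) > 0"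
    and C_fin: "integrable \<Lambda> (\<lambda>\<omega>. \<bar>mono (\<lambda>j. p j + q j) \<omega>\<bar>\<^sup>2 * (norm \<omega>)\<^sup>2)"
    and K_ge: "K \<ge> 1"
    and bernstein: "\<And>n::nat. n \<ge> 2 \<Longrightarrow>
        (\<integral>\<^sup>+\<omega>. ennreal (\<bar>mono (\<lambda>j. p j + q j) \<omega>\<bar> ^ n
             / (sqrt (\<integral>\<omega>. \<bar>mono (\<lambda>j. p j + q j) \<omega>\<bar>\<^sup>2 \<partial>\<Lambda>)) ^ n) \<partial>\<Lambda>)
        \<le> ennreal (fact n / 2 * K ^ (n - 2))"
    and m_pos: "m > 0"
    and t_pos: "t > 0"
    and S_cpt: "compact S"
  shows
    "let \<sigma> = sqrt (\<integral>\<omega>. \<bar>mono (\<lambda>j. p j + q j) \<omega>\<bar>\<^sup>2 \<partial>\<Lambda>);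
         C = sqrt (\<integral>\<omega>. \<bar>mono (\<lambda>j. p j + q j) \<omega>\<bar>\<^sup>2 * (norm \<omega>)\<^sup>2 \<partial>\<Lambda>) / \<sigma>;
         L = sqrt 6 * K / (2 * sqrt (real m));
         C1 = 14 * sqrt (6 * ln 2) + 1;
         C2 = 36 * K * (ln 2 + 1);
         C3 = 7 * sqrt 6 * (1 + sqrt pi / (ln 2) powr (3/2));
         d = real CARD('n);
         bnd = \<sigma> * (C3 * sqrt (d * ln (16 * diameter S * C + 4)) / sqrt (real m)
                 + C1 / sqrt (real m) + C2 / real m
                 + 24 * sqrt 6 / sqrt (real m) * (sqrt t + L * t / 2));
         M = PiM {..<m} (\<lambda>_. \<Lambda>);
         E = {W \<in> space M.
                (SUP xy \<in> S \<times> S. ereal \<bar>mpartial2 p q k (fst xy) (snd xy)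
                                     - rff_deriv p q m W (fst xy) (snd xy)\<bar>) \<ge> ereal bnd}
     in \<exists>A \<in> sets M. E \<subseteq> A \<and> measure M A \<le> 2 * exp (- t)"
proof -
  interpret prob_space \<Lambda> by (rule prob)
  note [measurable_cong] = borel
  define f where "f = mono (\<lambda>j. p j + q j)"
  have f[measurable]: "f \<in> borel_measurable borel"
    unfolding f_def mono_def[abs_def] by measurable
  define \<sigma> where "\<sigma> = sqrt (\<integral>\<omega>. \<bar>f \<omega>\<bar>\<^sup>2 \<partial>\<Lambda>)"
  define C where "C = sqrt (\<integral>\<omega>. \<bar>f \<omega>\<bar>\<^sup>2 * (norm \<omega>)\<^sup>2 \<partial>\<Lambda>) / \<sigma>"
  define R where "R = diameter S"
  define \<phi> where "\<phi> = (real (length (mi_list p)) - real (length (mi_list q))) * (pi / 2)"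
  \<comment> \<open>Division by \<open>\<sigma>\<close> turns the Bernstein condition into the
    moment condition on the envelope \<open>H\<close>. The Lipschitz constant of \<open>h\<close> in
    \<open>z\<close> is \<open>B\<close>, with second moment \<open>C\<^sup>2\<close>.\<close>
  define h where "h z \<omega> = f \<omega> / \<sigma> * cos (\<omega> \<bullet> z + \<phi>)" for z \<omega>
  define H where "H \<omega> = \<bar>f \<omega>\<bar> / \<sigma>" for \<omega>
  define B where "B \<omega> = H \<omega> * norm \<omega>" for \<omega>
  have \<sigma>: "\<sigma> > 0" using sigma_pos by (simp add: \<sigma>_def f_def)
  have R: "R \<ge> 0" using S_cpt by (simp add: R_def diameter_ge_0 compact_imp_bounded)
  have hm: "h z \<in> borel_measurable \<Lambda>" for z unfolding h_def by measurable
  have Hm: "H \<in> borel_measurable \<Lambda>" unfolding H_def by measurable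
  have Bm: "B \<in> borel_measurable \<Lambda>" unfolding B_def H_def by measurable
  have "f \<in> borel_measurable \<Lambda>" by measurable
  moreover have "integrable \<Lambda> (\<lambda>\<omega>. (f \<omega>)\<^sup>2)" using sigma_int by (simp add: f_def)
  ultimately have fi: "integrable \<Lambda> f" by (rule square_integrable_imp_integrable)
  have H0: "0 \<le> H \<omega>" for \<omega> using \<sigma> by (simp add: H_def)
  have hH: "\<bar>h z \<omega>\<bar> \<le> H \<omega>" for z \<omega>
  proof -
    have "\<bar>h z \<omega>\<bar> = H \<omega> * \<bar>cos (\<omega> \<bullet> z + \<phi>)\<bar>" using \<sigma> by (simp add: h_def H_def abs_mult)
    also have "\<dots> \<le> H \<omega>" using H0 by (intro mult_left_le) auto
    finally show ?thesis .
  qed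
  have mom: "(\<integral>\<^sup>+\<omega>. ennreal (H \<omega> ^ n) \<partial>\<Lambda>) \<le> ennreal (fact n / 2 * K ^ (n - 2))" if "n \<ge> 2" for n
    using bernstein[OF that] by (simp add: H_def power_divide f_def \<sigma>_def)
  have lip: "\<bar>h z \<omega> - h z' \<omega>\<bar> \<le> dist z z' * B \<omega>" for z z' \<omega>
  proof -
    have "\<bar>cos (\<omega> \<bullet> z + \<phi>) - cos (\<omega> \<bullet> z' + \<phi>)\<bar> \<le> \<bar>(\<omega> \<bullet> z + \<phi>) - (\<omega> \<bullet> z' + \<phi>)\<bar>"
      by (rule abs_cos_diff_le)
    also have "\<dots> = \<bar>\<omega> \<bullet> (z - z')\<bar>" by (simp add: inner_diff_right)
    also have "\<dots> \<le> norm \<omega> * dist z z'" by (simp add: dist_norm Cauchy_Schwarz_ineq2)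
    finally have "H \<omega> * \<bar>cos (\<omega> \<bullet> z + \<phi>) - cos (\<omega> \<bullet> z' + \<phi>)\<bar> \<le> H \<omega> * (norm \<omega> * dist z z')"
      using H0 by (rule mult_left_mono)
    moreover have "\<bar>h z \<omega> - h z' \<omega>\<bar> = H \<omega> * \<bar>cos (\<omega> \<bullet> z + \<phi>) - cos (\<omega> \<bullet> z' + \<phi>)\<bar>"
      unfolding h_def H_def right_diff_distrib[symmetric] using \<sigma> by (simp add: abs_mult)
    ultimately show ?thesis by (simp add: B_def mult_ac)
  qed
  have Bsq: "(\<lambda>\<omega>. (B \<omega>)\<^sup>2) = (\<lambda>\<omega>. (\<bar>f \<omega>\<bar>\<^sup>2 * (norm \<omega>)\<^sup>2) / \<sigma>\<^sup>2)"
    by (simp add: fun_eq_iff B_def H_def power_mult_distrib power_divide)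
  have B2: "integrable \<Lambda> (\<lambda>\<omega>. (B \<omega>)\<^sup>2)" "expectation (\<lambda>\<omega>. (B \<omega>)\<^sup>2) \<le> C\<^sup>2" "C \<ge> 0"
    unfolding Bsq using C_fin \<sigma> by (simp_all add: f_def C_def power_divide)
  define a where "a = 10 * sqrt (2 * card {..<m} * (DIM(real^'n) * ln (16 * R * C + 4))) + sqrt (card {..<m})
      + 5 * sqrt (t * card {..<m}) + 2 * K * t"
  let ?P = "PiM {..<m} (\<lambda>_. \<Lambda>)"
  let ?X = "\<lambda>z W. \<Sum>j<m. h z (W j) - expectation (h z)"
  have "\<exists>A\<in>sets ?P. {W \<in> space ?P. \<exists>z\<in>cball 0 R. a < \<bar>?X z W\<bar>} \<subseteq> A \<and> measure ?P A \<le> exp (- t)"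
    unfolding a_def using m_pos
    by (intro sup_abs_sum_tail[OF _ _ hm Hm hH mom Bm _ lip B2 K_ge t_pos R]) (auto simp: B_def H0)
  then obtain A where A: "A \<in> sets ?P" "{W \<in> space ?P. \<exists>z\<in>cball 0 R. a < \<bar>?X z W\<bar>} \<subseteq> A"
    "measure ?P A \<le> exp (- t)" by blast
  define bnd where "bnd = \<sigma> * (7 * sqrt 6 * (1 + sqrt pi / (ln 2) powr (3/2)) *
      sqrt (real CARD('n) * ln (16 * R * C + 4)) / sqrt (real m)
    + (14 * sqrt (6 * ln 2) + 1) / sqrt (real m) + 36 * K * (ln 2 + 1) / real m
    + 24 * sqrt 6 / sqrt (real m) * (sqrt t + sqrt 6 * K / (2 * sqrt (real m)) * t / 2))"
  have "0 \<le> ln (16 * R * C + 4)" using R B2(3) by (intro ln_ge_zero) auto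
  then have ab: "\<sigma> * (a / m) < bnd"
    unfolding bnd_def a_def using deviation_less_bound[of m "real CARD('n)" "ln (16 * R * C + 4)" K t] \<sigma> m_pos K_ge t_pos
    by (intro mult_strict_left_mono) auto
  \<comment> \<open>The deviation depends on \<open>x - y\<close> only, so the supremum runs over a
    set of dimension \<open>CARD('n)\<close> rather than twice that.\<close>
  have dev: "\<bar>mpartial2 p q k x y - rff_deriv p q m W x y\<bar> = \<sigma> * (\<bar>?X (x - y) W\<bar> / m)" for x y W
  proof -
    have h: "f \<omega> * cos (\<omega> \<bullet> (x - y) + \<phi>) = \<sigma> * h (x - y) \<omega>" for \<omega>
      using \<sigma> by (simp add: h_def)
    have "mpartial2 p q k x y = \<sigma> * expectation (h (x - y))"
      using mpartial2_eq_integral[OF prob borel kernel deriv_ex fi[unfolded f_def], of x y]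
      unfolding f_def[symmetric] \<phi>_def[symmetric] h by simp
    moreover have "rff_deriv p q m W x y = \<sigma> * ((\<Sum>j<m. h (x - y) (W j)) / m)"
      unfolding rff_deriv_eq_sum f_def[symmetric] \<phi>_def[symmetric] h by (simp add: sum_distrib_left)
    ultimately have "mpartial2 p q k x y - rff_deriv p q m W x y = - (\<sigma> * (?X (x - y) W / m))"
      using m_pos by (simp add: sum_subtractf field_simps)
    then show ?thesis using \<sigma> by (simp add: abs_mult)
  qed
  let ?dev = "\<lambda>W xy. ereal \<bar>mpartial2 p q k (fst xy) (snd xy) - rff_deriv p q m W (fst xy) (snd xy)\<bar>"
  have "{W \<in> space ?P. (SUP xy \<in> S \<times> S. ?dev W xy) \<ge> ereal bnd} \<subseteq> A"
  proof (rule subsetI)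
    fix W assume "W \<in> {W \<in> space ?P. (SUP xy \<in> S \<times> S. ?dev W xy) \<ge> ereal bnd}"
    then have W: "W \<in> space ?P" and sup: "ereal bnd \<le> (SUP xy \<in> S \<times> S. ?dev W xy)"
      by blast+
    \<comment> \<open>The strict gap gives a pair exceeding \<open>\<sigma> * (a / m)\<close>,
      whether or not the supremum is attained.\<close>
    have "ereal (\<sigma> * (a / m)) < ereal bnd" using ab by simp
    also note sup
    finally obtain xy where "xy \<in> S \<times> S" "ereal (\<sigma> * (a / m)) < ?dev W xy"
      unfolding less_SUP_iff by blast
    then obtain x y where xy: "x \<in> S" "y \<in> S"
      "\<sigma> * (a / m) < \<bar>mpartial2 p q k x y - rff_deriv p q m W x y\<bar>"
      using that[of "fst xy" "snd xy"] by (simp add: mem_Times_iff)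
    have "a < \<bar>?X (x - y) W\<bar>"
      using xy(3) \<sigma> m_pos unfolding dev by (simp add: divide_less_cancel)
    moreover have "x - y \<in> cball 0 R"
      using diameter_bounded_bound[OF compact_imp_bounded[OF S_cpt] xy(1,2)] by (simp add: R_def dist_norm norm_minus_commute)
    ultimately show "W \<in> A" using A(2) W by blast
  qed
  moreover have "measure ?P A \<le> 2 * exp (- t)" using A(3) exp_gt_zero[of "- t"] by linarith
  ultimately show ?thesis
    unfolding Let_def f_def[symmetric] \<sigma>_def[symmetric] C_def[symmetric] R_def[symmetric] bnd_def[symmetric]
    using A(1) by blast
qed

end
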